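(* Let $(A,\alpha)$ be a unital C*-dynamical system of multiplicity $d$. Then the mapping $\tau\mapsto\psi_\tau$ with $$\psi_\tau(V_\mu a V_\nu^* )=\begin{cases}\tau(a) & \text{for } \mu=\emptyset=\nu,\\ 0 & \text{otherwise},\end{cases}\qquad a\in A,\ \mu,\nu\in\mathbb{F}_+^d,$$ is an affine weak*-homeomorphism from the tracial state space $T(A)$ onto the space of the KMS$_\infty$ states on $\mathcal{T}(A,\alpha)$.
   Context: A unital C*-dynamical system $(A,\alpha)$ of multiplicity $d$ (with $1 \le d < \infty$) consists of a unital C*-algebra $A$ and $d$ unital $*$-endomorphisms $\alpha_1,\dots,\alpha_d$ of $A$. $\mathbb{F}_+^d$ is the free semigroup (monoid) of words on $d$ symbols, with empty word $\emptyset$; $|\mu|$ is the length of $\mu$. $\mathcal{T}(A,\alpha)$ (the Toeplitz-Pimsner algebra) is the universal C*-algebra generated by $A$ and elements $V_1,\dots,V_d$ such that $[V_1,\dots,V_d]$ is a row isometry ($V_i^*V_j = \delta_{i,j}1$) and $aV_i = V_i\alpha_i(a)$ for all $a\in A$, $i=1,\dots,d$. The algebra $A$ embeds in it isometrically and the unit of $A$ is its unit. For a word $\mu=\mu_n\cdots\mu_1$ write $V_\mu = V_{\mu_n}\cdots V_{\mu_1}$, with $V_\emptyset = 1$. The elements $V_\mu a V_\nu^*$ span a dense $*$-subalgebra. The gauge action $\{\gamma_z\}_{z\in\mathbb{T}}$ satisfies $\gamma_z(a)=a$, $\gamma_z(V_i)=zV_i$, and $\sigma:\mathbb{R}\to \mathrm{Aut}(\mathcal{T}(A,\alpha))$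 is $\sigma_t=\gamma_{e^{it}}$, so $\sigma_t(V_\mu aV_\nu^* )=e^{i(|\mu|-|\nu|)t}V_\mu aV_\nu^*$. For $\beta\in\mathbb{R}$, a state $\psi$ on a C*-algebra $B$ with an action $\sigma$ of $\mathbb{R}$ is a $(\sigma,\beta)$-KMS state if $\psi(xy)=\psi(y\sigma_{i\beta}(x))$ for all $x,y$ in a norm-dense $\sigma$-invariant $*$-subalgebra of the analytic elements of $B$ (elements $x$ for which $t\mapsto\sigma_t(x)$ extends to an entire function $z\mapsto\sigma_z(x)$). A state is a KMS$_\infty$ state if it is a weak*-limit of $(\sigma,\beta)$-KMS states as $\beta\to\infty$. *)

theory Defs
  imports "HOL-Analysis.Analysis" "HOL-Library.Poly_Mapping" "HOL-Library.Nonpos_Ints"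
begin

section \<open>Unital C*-algebras\<close>

text \<open>The unit has norm one, so the zero algebra is excluded.\<close>

class unital_cstar_algebra = real_normed_algebra_1 + banach +
  fixes scaleC :: "complex \<Rightarrow> 'a \<Rightarrow> 'a"  (infixr "*\<^sub>C" 75)
    and star :: "'a \<Rightarrow> 'a"
  assumes scaleC_add_right: "c *\<^sub>C (x + y) = c *\<^sub>C x + c *\<^sub>C y"
    and scaleC_add_left: "(b + c) *\<^sub>C x = b *\<^sub>C x + c *\<^sub>C x"
    and scaleC_scaleC: "b *\<^sub>C (c *\<^sub>C x) = (b * c) *\<^sub>C x"
    and scaleC_of_real: "complex_of_real r *\<^sub>C x = r *\<^sub>R x"
    and mult_scaleC_left: "(c *\<^sub>C x) * y = c *\<^sub>C (x * y)"
    and mult_scaleC_right: "x * (c *\<^sub>C y) = c *\<^sub>C (x * y)"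
    and norm_scaleC: "norm (c *\<^sub>C x) = cmod c * norm x"
    and star_star: "star (star x) = x"
    and star_add: "star (x + y) = star x + star y"
    and star_scaleC: "star (c *\<^sub>C x) = cnj c *\<^sub>C star x"
    and star_mult: "star (x * y) = star y * star x"
    and cstar_identity: "norm (star x * x) = (norm x)\<^sup>2"

definition unital_star_hom :: "('a::unital_cstar_algebra \<Rightarrow> 'b::unital_cstar_algebra) \<Rightarrow> bool" where
  "unital_star_hom f \<longleftrightarrow>
     (\<forall>x y. f (x + y) = f x + f y) \<and> (\<forall>c x. f (c *\<^sub>C x) = c *\<^sub>C f x) \<and>
     (\<forall>x y. f (x * y) = f x * f y) \<and> (\<forall>x. f (star x) = star (f x)) \<and> f 1 = 1"

lemma scaleC_zero_left [simp]: "0 *\<^sub>C x = (0::'a::unital_cstar_algebra)"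
  using scaleC_of_real[of 0 x] by simp

lemma scaleC_zero_right [simp]: "c *\<^sub>C 0 = (0::'a::unital_cstar_algebra)"
  using scaleC_add_right[of c 0 "0::'a"] by simp

lemma scaleC_one [simp]: "1 *\<^sub>C x = (x::'a::unital_cstar_algebra)"
  using scaleC_of_real[of 1 x] by simp

lemma scaleC_minus1: "(- 1) *\<^sub>C x = - (x::'a::unital_cstar_algebra)"
  using scaleC_of_real[of "-1" x] by simp

lemma scaleC_sum_right: "c *\<^sub>C (\<Sum>i\<in>I. f i) = (\<Sum>i\<in>I. c *\<^sub>C (f i :: 'a::unital_cstar_algebra))"
  by (induction I rule: infinite_finite_induct) (simp_all add: scaleC_add_right)

lemma star_zero [simp]: "star 0 = (0::'a::unital_cstar_algebra)"
  using star_add[of 0 "0::'a"] by simp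

lemma star_one [simp]: "star 1 = (1::'a::unital_cstar_algebra)"
  using star_mult[of 1 "star (1::'a)"] by (simp add: star_star)

lemma star_minus: "star (- x) = - star (x::'a::unital_cstar_algebra)"
  using star_add[of x "- x"] by (simp add: eq_neg_iff_add_eq_0 add.commute)

lemma star_diff: "star (x - y) = star x - star (y::'a::unital_cstar_algebra)"
  using star_add[of x "- y"] by (simp add: star_minus)

lemma star_scaleR: "star (r *\<^sub>R x) = r *\<^sub>R star (x::'a::unital_cstar_algebra)"
  using star_scaleC[of "complex_of_real r" x] by (simp add: scaleC_of_real)

lemma norm_star: "norm (star x) = norm (x::'a::unital_cstar_algebra)"
proof -
  have le: "norm y \<le> norm (star y)" for y :: 'a
  proof (cases "y = 0")
    case False
    have "norm y * norm y \<le> norm (star y) * norm y"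
      using norm_mult_ineq[of "star y" y] by (simp add: cstar_identity power2_eq_square)
    then show ?thesis using False by simp
  qed simp
  show ?thesis using le[of x] le[of "star x"] by (simp add: star_star)
qed

lemma bounded_linear_star: "bounded_linear (star :: 'a::unital_cstar_algebra \<Rightarrow> 'a)"
  by (rule bounded_linear_intro[where K = 1]) (simp_all add: star_add star_scaleR norm_star)

lemma unital_star_homD:
  assumes "unital_star_hom f"
  shows "f (x + y) = f x + f y" "f (c *\<^sub>C x) = c *\<^sub>C f x" "f (x * y) = f x * f y"
    "f (star x) = star (f x)" "f 1 = 1" "f 0 = 0" "f (- x) = - f x" "f (x - y) = f x - f y"
    "f (r *\<^sub>R x) = r *\<^sub>R f x"
proof -
  show add: "f (x + y) = f x + f y" and sc: "f (c *\<^sub>C x) = c *\<^sub>C f x" for x y c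
    using assms by (auto simp: unital_star_hom_def)
  show "f (x * y) = f x * f y" "f (star x) = star (f x)" "f 1 = 1"
    using assms by (auto simp: unital_star_hom_def)
  show "f 0 = 0" using sc[of 0 0] by simp
  show m: "f (- x) = - f x" for x using sc[of "-1" x] by (simp add: scaleC_minus1)
  show "f (x - y) = f x - f y" using add[of x "- y"] m[of y] by simp
  show "f (r *\<^sub>R x) = r *\<^sub>R f x"
    using sc[of "complex_of_real r" x] by (simp add: scaleC_of_real)
qed

text \<open>
  Automatic contractivity of *-homomorphisms. For self-adjoint \<open>h\<close> of norm below one,
  \<open>h + i (1 - h\<^sup>2)\<^sup>1\<^sup>/\<^sup>2\<close> is unitary; the root is given by the binomial series.
\<close>

lemma abs_half_gchoose_le: "\<bar>(1/2 :: real) gchoose n\<bar> \<le> 1"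
proof (induction n)
  case (Suc n)
  have "(1/2 :: real) gchoose Suc n = (1/2 gchoose n) * ((1/2 - real n) / (real n + 1))"
    by (simp add: gbinomial_mult_1' field_simps flip: gbinomial_absorb_comp)
       (use gbinomial_mult_1[of "1/2::real" n] in \<open>simp add: field_simps\<close>)
  moreover have "\<bar>(1/2 - real n) / (real n + 1)\<bar> \<le> 1"
    by (simp add: abs_le_iff field_simps)
  ultimately show ?case
    using Suc mult_mono[of "\<bar>1/2 gchoose n :: real\<bar>" 1 "\<bar>(1/2 - real n) / (real n + 1)\<bar>" 1]
    by (simp add: abs_mult)
qed simp

lemma square_root_exists:
  fixes x :: "'a::unital_cstar_algebra"
  assumes "norm x < 1" and "star x = x"
  obtains s where "s * s = 1 + x" "star s = s" "\<And>y. y * x = x * y \<Longrightarrow> y * s = s * y"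
proof -
  let ?c = "\<lambda>n. (1/2 :: real) gchoose n"
  let ?t = "\<lambda>n. ?c n *\<^sub>R x ^ n"
  have sn: "summable (\<lambda>n. norm (?t n))"
  proof (rule summable_comparison_test)
    have "norm (norm (?t n)) \<le> norm x ^ n" for n
    proof -
      have "norm (?t n) \<le> \<bar>?c n\<bar> * norm x ^ n"
        by (simp add: mult_left_mono norm_power_ineq)
      also have "\<dots> \<le> 1 * norm x ^ n"
        by (rule mult_right_mono[OF abs_half_gchoose_le]) simp
      finally show ?thesis by simp
    qed
    then show "\<exists>N. \<forall>n\<ge>N. norm (norm (?t n)) \<le> norm x ^ n" by blast
    show "summable (\<lambda>n. norm x ^ n)" using assms by (simp add: summable_geometric)
  qed
  then have sm: "summable ?t" by (rule summable_norm_cancel)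
  define s where "s = suminf ?t"
  have conv: "(\<Sum>i\<le>k. ?t i * ?t (k - i)) = (if k = 0 then 1 else if k = 1 then x else 0)" for k
  proof -
    have "(\<Sum>i\<le>k. ?t i * ?t (k - i)) = (\<Sum>i\<le>k. (?c i * ?c (k - i)) *\<^sub>R x ^ k)"
      by (rule sum.cong) (simp_all flip: power_add)
    also have "\<dots> = (1 gchoose k) *\<^sub>R x ^ k"
      using gbinomial_Vandermonde[of "1/2::real" "1/2" k]
      by (simp add: atLeast0AtMost flip: scaleR_sum_left)
    also have "(1 gchoose k) = real (1 choose k)"
      using binomial_gbinomial[of 1 k, where 'a = real] by simp
    finally show ?thesis by (cases k; cases "k - 1") auto
  qed
  have "s * s = suminf (\<lambda>k. \<Sum>i\<le>k. ?t i * ?t (k - i))"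
    unfolding s_def by (rule Cauchy_product[OF sn sn])
  also have "\<dots> = suminf (\<lambda>k. if k = 0 then 1 else if k = 1 then x else 0)"
    by (simp only: conv)
  also have "\<dots> = (\<Sum>k\<in>{0, 1::nat}. if k = 0 then 1 else if k = 1 then x else 0)"
    by (rule suminf_finite) auto
  also have "\<dots> = 1 + x" by simp
  finally have "s * s = 1 + x" .
  moreover have "star s = s"
  proof -
    have "star (x ^ n) = x ^ n" for n
      by (induction n) (simp_all add: star_mult assms power_commutes)
    then show ?thesis
      unfolding s_def by (simp add: bounded_linear.suminf[OF bounded_linear_star sm] star_scaleR)
  qed
  moreover have "y * s = s * y" if "y * x = x * y" for y
  proof -
    have "y * x ^ n = x ^ n * y" for n
      by (induction n) (simp_all, metis mult.assoc that)
    then show ?thesis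
      unfolding s_def suminf_mult[OF sm, symmetric] suminf_mult2[OF sm] by simp
  qed
  ultimately show thesis by (rule that)
qed

lemma star_hom_contractive:
  assumes f: "unital_star_hom f"
  shows "norm (f x) \<le> norm x"
proof -
  note hom = unital_star_homD[OF f]
  have *: "norm (f h) \<le> 1" if h: "star h = h" "norm h < 1" for h
  proof -
    have "norm (- (h * h)) < 1"
      using h cstar_identity[of h] by (simp add: abs_square_less_1)
    moreover have "star (- (h * h)) = - (h * h)"
      by (simp add: star_minus star_mult h)
    ultimately obtain s where s: "s * s = 1 + - (h * h)" "star s = s"
      and comm: "\<And>y. y * - (h * h) = - (h * h) * y \<Longrightarrow> y * s = s * y"
      by (rule square_root_exists) blast
    have hs: "h * s = s * h" by (rule comm) (simp add: mult.assoc)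
    define u where "u = h + \<i> *\<^sub>C s"
    have su: "star u = h + (- \<i>) *\<^sub>C s"
      by (simp add: u_def star_add star_scaleC h s)
    have "star u * u = h * h + s * s + (\<i> *\<^sub>C (h * s) + (- \<i>) *\<^sub>C (s * h))"
      by (simp add: su, simp add: u_def algebra_simps mult_scaleC_left mult_scaleC_right
          scaleC_scaleC scaleC_add_right)
    also have "\<i> *\<^sub>C (h * s) + (- \<i>) *\<^sub>C (s * h) = 0"
      by (simp add: hs flip: scaleC_add_left)
    finally have "star u * u = 1" using s by simp
    then have "norm (star (f u) * f u) = 1"
      by (metis hom(3,4,5) norm_one)
    then have nu: "norm (f u) = 1"
      by (simp add: cstar_identity power2_eq_1_iff)
        (smt (verit) norm_ge_zero)
    have "u + star u = 2 *\<^sub>R h"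
    proof -
      have "\<i> *\<^sub>C s + (- \<i>) *\<^sub>C s = 0" by (simp flip: scaleC_add_left)
      then show ?thesis
        unfolding su unfolding u_def by (simp add: algebra_simps scaleR_2)
    qed
    then have "2 * norm (f h) = norm (f u + star (f u))"
      by (metis abs_numeral hom(1,4,9) norm_scaleR)
    also have "\<dots> \<le> 2" using norm_triangle_ineq[of "f u" "star (f u)"] nu by (simp add: norm_star)
    finally show ?thesis by simp
  qed
  have sa: "norm (f h) \<le> norm h" if h: "star h = h" for h
  proof (rule dense_ge)
    fix r assume r: "norm h < r"
    then have "r > 0" by (smt (verit) norm_ge_zero)
    then have "norm (f ((1 / r) *\<^sub>R h)) \<le> 1"
      using r by (intro *) (simp_all add: star_scaleR h)
    then show "norm (f h) \<le> r" using \<open>r > 0\<close> by (simp add: hom(9) field_simps)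
  qed
  have "(norm (f x))\<^sup>2 = norm (f (star x * x))" by (simp add: hom cstar_identity)
  also have "\<dots> \<le> norm (star x * x)" by (rule sa) (simp add: star_mult star_star)
  also have "\<dots> = (norm x)\<^sup>2" by (rule cstar_identity)
  finally show ?thesis by (rule power2_le_imp_le) simp
qed


section \<open>States\<close>

definition state :: "('a::unital_cstar_algebra \<Rightarrow> complex) \<Rightarrow> bool" where
  "state \<phi> \<longleftrightarrow>
     bounded_linear \<phi> \<and> (\<forall>c x. \<phi> (c *\<^sub>C x) = c * \<phi> x) \<and>
     (\<forall>x. \<phi> (star x * x) \<in> \<real>\<^sub>\<ge>\<^sub>0) \<and> onorm \<phi> = 1"

definition tracial_states :: "('a::unital_cstar_algebra \<Rightarrow> complex) set" where
  "tracial_states = {\<tau>. state \<tau> \<and> (\<forall>a b. \<tau> (a * b) = \<tau> (b * a))}"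

text \<open>The weak* topology on a set of functionals: the topology of pointwise convergence.\<close>

definition weak_star :: "('a \<Rightarrow> complex) set \<Rightarrow> ('a \<Rightarrow> complex) topology" where
  "weak_star S = subtopology (product_topology (\<lambda>_. euclidean) UNIV) S"


section \<open>KMS states\<close>

definition entire :: "(complex \<Rightarrow> 'a::unital_cstar_algebra) \<Rightarrow> bool" where
  "entire f \<longleftrightarrow> (\<forall>z. \<exists>D. ((\<lambda>h. inverse h *\<^sub>C (f (z + h) - f z)) \<longlongrightarrow> D) (at 0))"

definition entire_extension ::
  "(real \<Rightarrow> 'a::unital_cstar_algebra \<Rightarrow> 'a) \<Rightarrow> 'a \<Rightarrow> (complex \<Rightarrow> 'a) \<Rightarrow> bool" where
  "entire_extension \<sigma> x f \<longleftrightarrow> entire f \<and> (\<forall>t. f (complex_of_real t) = \<sigma> t x)"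

definition analytic_elements :: "(real \<Rightarrow> 'a::unital_cstar_algebra \<Rightarrow> 'a) \<Rightarrow> 'a set" where
  "analytic_elements \<sigma> = {x. \<exists>f. entire_extension \<sigma> x f}"

definition star_subalgebra :: "'a::unital_cstar_algebra set \<Rightarrow> bool" where
  "star_subalgebra D \<longleftrightarrow>
     0 \<in> D \<and> (\<forall>x\<in>D. \<forall>y\<in>D. x + y \<in> D \<and> x * y \<in> D) \<and>
     (\<forall>x\<in>D. (\<forall>c. c *\<^sub>C x \<in> D) \<and> star x \<in> D)"

text \<open>
  The entire extension of an orbit map is unique by the identity theorem, so that the
  quantifier over \<open>f\<close> below ranges over the single function \<open>z \<mapsto> \<sigma>\<^sub>z(x)\<close>, which exists
  for every \<open>x \<in> D\<close>.
\<close>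

definition kms_state ::
  "(real \<Rightarrow> 'a::unital_cstar_algebra \<Rightarrow> 'a) \<Rightarrow> real \<Rightarrow> ('a \<Rightarrow> complex) \<Rightarrow> bool" where
  "kms_state \<sigma> \<beta> \<psi> \<longleftrightarrow> state \<psi> \<and>
     (\<exists>D. star_subalgebra D \<and> D \<subseteq> analytic_elements \<sigma> \<and> closure D = UNIV \<and>
          (\<forall>t. \<sigma> t ` D \<subseteq> D) \<and>
          (\<forall>x\<in>D. \<forall>y\<in>D. \<forall>f. entire_extension \<sigma> x f \<longrightarrow>
              \<psi> (x * y) = \<psi> (y * f (\<i> * complex_of_real \<beta>))))"

text \<open>
  Weak*-limits of nets: a net of pairs \<open>(\<beta>, \<phi>)\<close>, \<open>\<phi>\<close> a \<open>(\<sigma>, \<beta>)\<close>-KMS state, with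
  \<open>\<beta> \<rightarrow> \<infinity>\<close> and \<open>\<phi> \<rightarrow> \<psi>\<close> pointwise, is encoded by its eventuality filter.
\<close>

definition kms_infinity_states ::
  "(real \<Rightarrow> 'a::unital_cstar_algebra \<Rightarrow> 'a) \<Rightarrow> ('a \<Rightarrow> complex) set" where
  "kms_infinity_states \<sigma> = {\<psi>. state \<psi> \<and>
     (\<exists>F :: (real \<times> ('a \<Rightarrow> complex)) filter. F \<noteq> bot \<and>
        (\<forall>\<^sub>F (\<beta>, \<phi>) in F. kms_state \<sigma> \<beta> \<phi>) \<and>
        filterlim fst at_top F \<and>
        (\<forall>x. ((\<lambda>(\<beta>, \<phi>). \<phi> x) \<longlongrightarrow> \<psi> x) F))}"


section \<open>Universal C*-algebras given by generators and relations\<close>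

text \<open>
  The free unital *-algebra on a set of generators is the monoid algebra over the complex
  numbers of the free monoid on the letters \<open>g\<close>, \<open>g*\<close>; the letter \<open>(g, True)\<close> stands
  for \<open>g*\<close>.
\<close>

datatype 'g star_word = Word (letters: "('g \<times> bool) list")

instantiation star_word :: (type) monoid_add
begin
definition zero_star_word :: "'a star_word" where "0 = Word []"
definition plus_star_word :: "'a star_word \<Rightarrow> 'a star_word \<Rightarrow> 'a star_word" where
  "v + w = Word (letters v @ letters w)"
instance by standard (simp_all add: zero_star_word_def plus_star_word_def)
end

type_synonym 'g free_star_algebra = "'g star_word \<Rightarrow>\<^sub>0 complex"

definition gen :: "'g \<Rightarrow> 'g free_star_algebra" where
  "gen g = Poly_Mapping.single (Word [(g, False)]) 1"

definition free_scale :: "complex \<Rightarrow> 'g free_star_algebra \<Rightarrow> 'g free_star_algebra" where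
  "free_scale c x = Poly_Mapping.single 0 c * x"

definition word_star :: "'g star_word \<Rightarrow> 'g star_word" where
  "word_star w = Word (rev (map (\<lambda>(g, b). (g, \<not> b)) (letters w)))"

definition free_star :: "'g free_star_algebra \<Rightarrow> 'g free_star_algebra" where
  "free_star x =
     (\<Sum>w\<in>Poly_Mapping.keys x. Poly_Mapping.single (word_star w) (cnj (Poly_Mapping.lookup x w)))"

definition word_value :: "('g \<Rightarrow> 'b::unital_cstar_algebra) \<Rightarrow> 'g star_word \<Rightarrow> 'b" where
  "word_value u w = prod_list (map (\<lambda>(g, b). if b then star (u g) else u g) (letters w))"

text \<open>The unital *-homomorphism out of the free *-algebra with \<open>gen g \<mapsto> u g\<close>.\<close>

definition free_eval :: "('g \<Rightarrow> 'b::unital_cstar_algebra) \<Rightarrow> 'g free_star_algebra \<Rightarrow> 'b" where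
  "free_eval u x = (\<Sum>w\<in>Poly_Mapping.keys x. Poly_Mapping.lookup x w *\<^sub>C word_value u w)"

definition cstar_seminorm :: "('g free_star_algebra \<Rightarrow> real) \<Rightarrow> bool" where
  "cstar_seminorm p \<longleftrightarrow>
     (\<forall>x y. p (x + y) \<le> p x + p y) \<and> (\<forall>c x. p (free_scale c x) = cmod c * p x) \<and>
     (\<forall>x y. p (x * y) \<le> p x * p y) \<and> (\<forall>x. p (free_star x * x) = (p x)\<^sup>2)"

text \<open>
  The universal C*-algebra on given generators and relations is the Hausdorff completion of
  the free *-algebra in the largest C*-seminorm that vanishes on the relators. Thus \<open>u\<close>
  exhibits its codomain as this completion if the norm pulled back along \<open>free_eval u\<close> is
  that largest seminorm and \<open>free_eval u\<close> has dense range. The usual universal property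
  is the theorem \<open>universal_property\<close> below.
\<close>

definition universal_cstar ::
  "'g free_star_algebra set \<Rightarrow> ('g \<Rightarrow> 'b::unital_cstar_algebra) \<Rightarrow> bool" where
  "universal_cstar R u \<longleftrightarrow>
     (\<forall>r\<in>R. free_eval u r = 0) \<and>
     closure (range (free_eval u)) = UNIV \<and>
     (\<forall>p. cstar_seminorm p \<and> (\<forall>r\<in>R. p r = 0) \<longrightarrow> (\<forall>x. p x \<le> norm (free_eval u x)))"

lemma sum_keys_superset:
  assumes "finite S" "Poly_Mapping.keys x \<subseteq> S" "\<And>w. h w 0 = 0"
  shows "(\<Sum>w\<in>Poly_Mapping.keys x. h w (Poly_Mapping.lookup x w)) =
         (\<Sum>w\<in>S. h w (Poly_Mapping.lookup x w))"
  using assms by (intro sum.mono_neutral_left) (auto simp: in_keys_iff)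

lemma sum_keys_add:
  fixes h :: "'w \<Rightarrow> 'c::monoid_add \<Rightarrow> 'b::comm_monoid_add"
  assumes "\<And>w. h w 0 = 0" "\<And>w a b. h w (a + b) = h w a + h w b"
  shows "(\<Sum>w\<in>Poly_Mapping.keys (x + y). h w (Poly_Mapping.lookup (x + y) w)) =
         (\<Sum>w\<in>Poly_Mapping.keys x. h w (Poly_Mapping.lookup x w)) +
         (\<Sum>w\<in>Poly_Mapping.keys y. h w (Poly_Mapping.lookup y w))"
proof -
  let ?S = "Poly_Mapping.keys x \<union> Poly_Mapping.keys y"
  have S: "finite ?S" "Poly_Mapping.keys x \<subseteq> ?S" "Poly_Mapping.keys y \<subseteq> ?S"
    "Poly_Mapping.keys (x + y) \<subseteq> ?S"
    using Poly_Mapping.keys_add[of x y] by auto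
  show ?thesis
    unfolding sum_keys_superset[where h = h, OF S(1) S(2) assms(1)]
      sum_keys_superset[where h = h, OF S(1) S(3) assms(1)]
      sum_keys_superset[where h = h, OF S(1) S(4) assms(1)]
    by (simp add: lookup_add assms(2) sum.distrib)
qed

lemma free_induct [case_names single add]:
  fixes x :: "'w \<Rightarrow>\<^sub>0 'c::comm_monoid_add"
  assumes "\<And>w c. P (Poly_Mapping.single w c)" "\<And>x y. P x \<Longrightarrow> P y \<Longrightarrow> P (x + y)"
  shows "P x"
proof (induction x rule: Poly_Mapping.update_induct)
  case const
  then show ?case using assms(1)[of undefined 0] by simp
next
  case (update f a b)
  have "Poly_Mapping.update a b f = f + Poly_Mapping.single a b"
    using update by (intro poly_mapping_eqI)
      (auto simp: lookup_update lookup_add lookup_single when_def in_keys_iff)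
  then show ?case using assms update by simp
qed

lemma free_eval_add: "free_eval u (x + y) = free_eval u x + free_eval u y"
  unfolding free_eval_def by (rule sum_keys_add) (simp_all add: scaleC_add_left)

lemma free_eval_single: "free_eval u (Poly_Mapping.single w c) = c *\<^sub>C word_value u w"
  by (cases "c = 0") (simp_all add: free_eval_def)

lemma free_star_add: "free_star (x + y) = free_star x + free_star y"
  unfolding free_star_def by (rule sum_keys_add) (simp_all add: single_add)

lemma free_star_single:
  "free_star (Poly_Mapping.single w c) = Poly_Mapping.single (word_star w) (cnj c)"
  by (cases "c = 0") (simp_all add: free_star_def)

lemma word_value_add: "word_value u (v + w) = word_value u v * word_value u w"
  by (simp add: word_value_def plus_star_word_def)

lemma word_value_star: "word_value u (word_star w) = star (word_value u w)"
proof -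
  have "prod_list (map (\<lambda>(g, b). if b then star (u g) else u g)
          (rev (map (\<lambda>(g, b). (g, \<not> b)) l))) =
        star (prod_list (map (\<lambda>(g, b). if b then star (u g) else u g) l))" for l
    by (induction l) (auto simp: star_mult star_star)
  then show ?thesis by (simp add: word_value_def word_star_def)
qed

lemma free_eval_mult: "free_eval u (x * y) = free_eval u x * free_eval u y"
proof (induction x rule: free_induct)
  case (single v b)
  show ?case
  proof (induction y rule: free_induct)
    case (single w c)
    show ?case
      by (simp add: mult_single free_eval_single word_value_add mult_scaleC_left
          mult_scaleC_right scaleC_scaleC mult.commute)
  qed (simp add: free_eval_add distrib_left)
qed (simp add: free_eval_add distrib_right)

lemma free_eval_star: "free_eval u (free_star x) = star (free_eval u x)"
  by (induction x rule: free_induct)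
    (simp_all add: free_star_add free_eval_add star_add free_star_single free_eval_single
      star_scaleC word_value_star)

lemma free_eval_scale: "free_eval u (free_scale c x) = c *\<^sub>C free_eval u x"
  by (simp add: free_scale_def free_eval_mult free_eval_single word_value_def zero_star_word_def
      mult_scaleC_left)

lemma free_eval_one: "free_eval u 1 = 1"
  using free_eval_single[of u 0 1] unfolding single_one
  by (simp add: word_value_def zero_star_word_def)

lemma free_eval_zero: "free_eval u 0 = 0"
  by (simp add: free_eval_def)

lemma free_eval_minus: "free_eval u (x - y) = free_eval u x - free_eval u y"
  using free_eval_add[of u "x - y" y] by (simp add: algebra_simps)

lemma free_eval_gen: "free_eval u (gen g) = u g"
  by (simp add: gen_def free_eval_single word_value_def)

lemma cstar_seminorm_free_eval: "cstar_seminorm (\<lambda>x. norm (free_eval u x))"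
  by (simp add: cstar_seminorm_def free_eval_add free_eval_scale free_eval_mult free_eval_star
      norm_triangle_ineq norm_scaleC norm_mult_ineq cstar_identity)

lemma star_hom_free_eval:
  assumes "unital_star_hom f" "\<And>g. f (u g) = w g"
  shows "f (free_eval u x) = free_eval w x"
proof (induction x rule: free_induct)
  case (single v c)
  note hom = unital_star_homD[OF assms(1)]
  have "f (prod_list (map (\<lambda>(g, b). if b then star (u g) else u g) l)) =
        prod_list (map (\<lambda>(g, b). if b then star (w g) else w g) l)" for l
    by (induction l) (auto simp: hom assms(2))
  then show ?case by (simp add: free_eval_single hom word_value_def)
qed (simp add: free_eval_add unital_star_homD(1)[OF assms(1)])

lemma continuous_star_hom:
  assumes "unital_star_hom f" shows "continuous_on S f"
proof (rule linear_continuous_on, rule bounded_linear_intro[where K = 1])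
qed (simp_all add: unital_star_homD[OF assms] star_hom_contractive[OF assms])

lemma bounded_linear_scaleC: "bounded_linear (\<lambda>x::'b::unital_cstar_algebra. c *\<^sub>C x)"
  by (rule bounded_linear_intro[where K = "cmod c"])
    (simp_all add: scaleC_add_right norm_scaleC scaleC_scaleC mult.commute flip: scaleC_of_real)

lemma continuous_scaleC:
  "continuous_on S f \<Longrightarrow> continuous_on S (\<lambda>y. c *\<^sub>C (f y :: 'b::unital_cstar_algebra))"
  by (rule bounded_linear.continuous_on[OF bounded_linear_scaleC])

lemma continuous_star:
  "continuous_on S f \<Longrightarrow> continuous_on S (\<lambda>y. star (f y :: 'b::unital_cstar_algebra))"
  by (rule bounded_linear.continuous_on[OF bounded_linear_star])

lemma universal_cstar_ext:
  fixes F G :: "'b::unital_cstar_algebra \<Rightarrow> 'c::t2_space"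
  assumes "universal_cstar R u" and "continuous_on UNIV F" "continuous_on UNIV G"
    and "\<And>x. F (free_eval u x) = G (free_eval u x)"
  shows "F y = G y"
proof -
  have "closed {y. F y = G y}" using assms(2,3) by (rule closed_Collect_eq)
  moreover have "range (free_eval u) \<subseteq> {y. F y = G y}" using assms(4) by blast
  ultimately have "closure (range (free_eval u)) \<subseteq> {y. F y = G y}" by (rule closure_minimal[rotated])
  moreover have "closure (range (free_eval u)) = UNIV"
    using assms(1) unfolding universal_cstar_def by blast
  ultimately show ?thesis by blast
qed

theorem universal_property:
  fixes u :: "'g \<Rightarrow> 'b::unital_cstar_algebra" and w :: "'g \<Rightarrow> 'c::unital_cstar_algebra"
  assumes u: "universal_cstar R u" and w: "\<And>r. r \<in> R \<Longrightarrow> free_eval w r = 0"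
  shows "\<exists>!f. unital_star_hom f \<and> (\<forall>g. f (u g) = w g)"
proof (rule ex_ex1I)
  let ?X = "range (free_eval u)"
  have cl: "closure ?X = UNIV" using u unfolding universal_cstar_def by blast
  have le: "norm (free_eval w x) \<le> norm (free_eval u x)" for x
  proof -
    have "\<forall>r\<in>R. norm (free_eval w r) = 0" using w by simp
    with cstar_seminorm_free_eval[of w] u show ?thesis
      unfolding universal_cstar_def by blast
  qed
  have le': "norm (free_eval w x - free_eval w y) \<le> norm (free_eval u x - free_eval u y)" for x y
    using le[of "x - y"] by (simp only: free_eval_minus)
  define f0 where "f0 y = free_eval w (SOME x. free_eval u x = y)" for y
  have f0: "f0 (free_eval u x) = free_eval w x" for x
  proof -
    define x' where "x' = (SOME x'. free_eval u x' = free_eval u x)"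
    have "free_eval u x' = free_eval u x" unfolding x'_def by (rule someI) (rule refl)
    then have "norm (free_eval w x' - free_eval w x) \<le> 0" using le'[of x' x] by simp
    then show ?thesis unfolding f0_def x'_def by simp
  qed
  have "uniformly_continuous_on ?X f0"
  proof (rule lipschitz_on_uniformly_continuous[where L = 1], rule lipschitz_onI)
    fix y z assume "y \<in> ?X" "z \<in> ?X"
    then obtain a b where "y = free_eval u a" "z = free_eval u b" by blast
    then show "dist (f0 y) (f0 z) \<le> 1 * dist y z" using le'[of a b] by (simp add: f0 dist_norm)
  qed simp
  then obtain f where "uniformly_continuous_on (closure ?X) f" and f: "\<And>x. x \<in> ?X \<Longrightarrow> f0 x = f x"
    by (rule uniformly_continuous_on_extension_on_closure) blast
  then have cont: "continuous_on UNIV f" using cl by (simp add: uniformly_continuous_imp_continuous)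
  have ev: "f (free_eval u x) = free_eval w x" for x using f[of "free_eval u x"] f0 by simp
  note ext1 = universal_cstar_ext[OF u]
  note cf = continuous_on_compose2[OF cont _ subset_UNIV, of UNIV]
  have "f (y + z) = f y + f z" for y z
  proof -
    have "f (free_eval u x + z) = f (free_eval u x) + f z" for x z
    proof (rule ext1[where F = "\<lambda>z. f (free_eval u x + z)" and G = "\<lambda>z. f (free_eval u x) + f z"])
      show "f (free_eval u x + free_eval u x') = f (free_eval u x) + f (free_eval u x')" for x'
        by (simp add: ev flip: free_eval_add)
    qed (intro continuous_on_add continuous_on_mult continuous_on_const continuous_on_id cf)+
    note step = this
    show ?thesis
    proof (rule ext1[where F = "\<lambda>y. f (y + z)" and G = "\<lambda>y. f y + f z"])
    qed (rule step | intro continuous_on_add continuous_on_mult continuous_on_const continuous_on_id cf)+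
  qed
  moreover have "f (y * z) = f y * f z" for y z
  proof -
    have "f (free_eval u x * z) = f (free_eval u x) * f z" for x z
    proof (rule ext1[where F = "\<lambda>z. f (free_eval u x * z)" and G = "\<lambda>z. f (free_eval u x) * f z"])
      show "f (free_eval u x * free_eval u x') = f (free_eval u x) * f (free_eval u x')" for x'
        by (simp add: ev flip: free_eval_mult)
    qed (intro continuous_on_add continuous_on_mult continuous_on_const continuous_on_id cf)+
    note step = this
    show ?thesis
    proof (rule ext1[where F = "\<lambda>y. f (y * z)" and G = "\<lambda>y. f y * f z"])
    qed (rule step | intro continuous_on_add continuous_on_mult continuous_on_const continuous_on_id cf)+
  qed
  moreover have "f (c *\<^sub>C y) = c *\<^sub>C f y" for c y
  proof (rule ext1[where F = "\<lambda>y. f (c *\<^sub>C y)" and G = "\<lambda>y. c *\<^sub>C f y"])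
    show "f (c *\<^sub>C free_eval u x) = c *\<^sub>C f (free_eval u x)" for x
      by (simp add: ev flip: free_eval_scale)
  qed (intro cf continuous_scaleC continuous_on_id)+
  moreover have "f (star y) = star (f y)" for y
  proof (rule ext1[where F = "\<lambda>y. f (star y)" and G = "\<lambda>y. star (f y)"])
    show "f (star (free_eval u x)) = star (f (free_eval u x))" for x
      by (simp add: ev flip: free_eval_star)
  qed (intro cf continuous_star continuous_on_id)+
  moreover have "f 1 = 1" using ev[of 1] by (simp add: free_eval_one)
  moreover have "f (u g) = w g" for g using ev[of "gen g"] by (simp add: free_eval_gen)
  ultimately show "\<exists>f. unital_star_hom f \<and> (\<forall>g. f (u g) = w g)"
    unfolding unital_star_hom_def by blast
next
  fix f f' assume f: "unital_star_hom f \<and> (\<forall>g. f (u g) = w g)"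
    and f': "unital_star_hom f' \<and> (\<forall>g. f' (u g) = w g)"
  show "f = f'"
  proof (rule ext, rule universal_cstar_ext[OF u, where F = f and G = f'])
    show "f (free_eval u x) = f' (free_eval u x)" for x
      using star_hom_free_eval[of f u w x] star_hom_free_eval[of f' u w x] f f' by simp
  qed (use f f' continuous_star_hom in blast)+
qed


section \<open>The Toeplitz-Pimsner algebra of a C*-dynamical system\<close>

definition cstar_system :: "('d::finite \<Rightarrow> 'a::unital_cstar_algebra \<Rightarrow> 'a) \<Rightarrow> bool" where
  "cstar_system \<alpha> \<longleftrightarrow> (\<forall>i. unital_star_hom (\<alpha> i))"

text \<open>
  The generators are the elements of \<open>A\<close> (tagged by \<open>Inl\<close>) and \<open>V\<^sub>i\<close> (tagged by \<open>Inr\<close>).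
  The first five families of relators make \<open>A\<close> map in by a unital *-homomorphism.
\<close>

inductive_set toeplitz_relators ::
  "('d::finite \<Rightarrow> 'a::unital_cstar_algebra \<Rightarrow> 'a) \<Rightarrow> ('a + 'd) free_star_algebra set"
  for \<alpha> :: "'d \<Rightarrow> 'a \<Rightarrow> 'a" where
  "gen (Inl (a + b)) - (gen (Inl a) + gen (Inl b)) \<in> toeplitz_relators \<alpha>"
| "gen (Inl (c *\<^sub>C a)) - free_scale c (gen (Inl a)) \<in> toeplitz_relators \<alpha>"
| "gen (Inl (a * b)) - gen (Inl a) * gen (Inl b) \<in> toeplitz_relators \<alpha>"
| "gen (Inl (star a)) - free_star (gen (Inl a)) \<in> toeplitz_relators \<alpha>"
| "gen (Inl 1) - 1 \<in> toeplitz_relators \<alpha>"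
| "free_star (gen (Inr i)) * gen (Inr j) - (if i = j then 1 else 0) \<in> toeplitz_relators \<alpha>"
| "gen (Inl a) * gen (Inr i) - gen (Inr i) * gen (Inl (\<alpha> i a)) \<in> toeplitz_relators \<alpha>"

text \<open>
  \<open>toeplitz_algebra \<alpha> \<iota> V\<close>: the codomain type of \<open>\<iota>\<close> and \<open>V\<close> is (a copy of)
  \<open>\<T>(A,\<alpha>)\<close>, with \<open>\<iota>\<close> the canonical map of \<open>A\<close> and \<open>V\<close> the canonical row isometry.
\<close>

definition toeplitz_algebra ::
  "('d::finite \<Rightarrow> 'a::unital_cstar_algebra \<Rightarrow> 'a) \<Rightarrow>
   ('a \<Rightarrow> 't::unital_cstar_algebra) \<Rightarrow> ('d \<Rightarrow> 't) \<Rightarrow> bool" where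
  "toeplitz_algebra \<alpha> \<iota> V \<longleftrightarrow> universal_cstar (toeplitz_relators \<alpha>) (case_sum \<iota> V)"

lemma toeplitz_relations_iff:
  fixes W :: "'d::finite \<Rightarrow> 'b::unital_cstar_algebra"
  shows "(\<forall>r\<in>toeplitz_relators \<alpha>. free_eval (case_sum \<rho> W) r = 0) \<longleftrightarrow>
     unital_star_hom \<rho> \<and> (\<forall>i j. star (W i) * W j = (if i = j then 1 else 0)) \<and>
     (\<forall>a i. \<rho> a * W i = W i * \<rho> (\<alpha> i a))" (is "?L \<longleftrightarrow> ?R")
proof
  note ev = free_eval_minus free_eval_add free_eval_mult free_eval_scale free_eval_star
    free_eval_one free_eval_zero free_eval_gen
  assume L: ?L
  note rel = bspec[OF L toeplitz_relators.intros(1)] bspec[OF L toeplitz_relators.intros(2)]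
    bspec[OF L toeplitz_relators.intros(3)] bspec[OF L toeplitz_relators.intros(4)]
    bspec[OF L toeplitz_relators.intros(5)] bspec[OF L toeplitz_relators.intros(7)]
  have "star (W i) * W j = (if i = j then 1 else 0)" for i j
    using bspec[OF L toeplitz_relators.intros(6)[of i j]] by (cases "i = j") (simp_all add: ev)
  with rel show ?R by (simp add: ev unital_star_hom_def)
next
  assume R: ?R
  show ?L
  proof
    fix r assume "r \<in> toeplitz_relators \<alpha>"
    then show "free_eval (case_sum \<rho> W) r = 0"
      using R by cases (auto simp: free_eval_minus free_eval_add free_eval_mult free_eval_scale
          free_eval_star free_eval_one free_eval_zero free_eval_gen unital_star_hom_def)
  qed
qed

text \<open>The defining universal property of \<open>\<T>(A,\<alpha>)\<close>.\<close>

theorem toeplitz_universal_property: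
  fixes W :: "'d::finite \<Rightarrow> 'b::unital_cstar_algebra"
  assumes "toeplitz_algebra \<alpha> \<iota> V" and "unital_star_hom \<rho>"
    and "\<And>i j. star (W i) * W j = (if i = j then 1 else 0)"
    and "\<And>a i. \<rho> a * W i = W i * \<rho> (\<alpha> i a)"
  shows "\<exists>!f. unital_star_hom f \<and> (\<forall>a. f (\<iota> a) = \<rho> a) \<and> (\<forall>i. f (V i) = W i)"
proof -
  have "\<forall>r\<in>toeplitz_relators \<alpha>. free_eval (case_sum \<rho> W) r = 0"
    unfolding toeplitz_relations_iff using assms by blast
  then have "\<exists>!f. unital_star_hom f \<and> (\<forall>g. f (case_sum \<iota> V g) = case_sum \<rho> W g)"
    using assms(1) by (intro universal_property) (auto simp: toeplitz_algebra_def)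
  then show ?thesis by (simp add: split_sum_all)
qed

lemma toeplitz_relations:
  assumes "toeplitz_algebra \<alpha> \<iota> V"
  shows "unital_star_hom \<iota>" "star (V i) * V j = (if i = j then 1 else 0)"
    "\<iota> a * V i = V i * \<iota> (\<alpha> i a)"
proof -
  have "\<forall>r\<in>toeplitz_relators \<alpha>. free_eval (case_sum \<iota> V) r = 0"
    using assms by (simp add: toeplitz_algebra_def universal_cstar_def)
  then show "unital_star_hom \<iota>" "star (V i) * V j = (if i = j then 1 else 0)"
    "\<iota> a * V i = V i * \<iota> (\<alpha> i a)"
    unfolding toeplitz_relations_iff by blast+
qed


text \<open>The word \<open>\<mu>\<^sub>n\<dots>\<mu>\<^sub>1\<close> is the list \<open>[\<mu>\<^sub>n, \<dots>, \<mu>\<^sub>1]\<close>.\<close>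

definition word_prod :: "('d \<Rightarrow> 't::unital_cstar_algebra) \<Rightarrow> 'd list \<Rightarrow> 't" where
  "word_prod V \<mu> = prod_list (map V \<mu>)"

theorem gauge_ex1:
  fixes \<alpha> :: "'d::finite \<Rightarrow> 'a::unital_cstar_algebra \<Rightarrow> 'a"
    and \<iota> :: "'a \<Rightarrow> 't::unital_cstar_algebra"
  assumes T: "toeplitz_algebra \<alpha> \<iota> V" and "cmod z = 1"
  shows "\<exists>!f. unital_star_hom f \<and> bij f \<and> (\<forall>a. f (\<iota> a) = \<iota> a) \<and> (\<forall>i. f (V i) = z *\<^sub>C V i)"
proof -
  let ?P = "\<lambda>z f. unital_star_hom f \<and> (\<forall>a. f (\<iota> a) = \<iota> a) \<and> (\<forall>i. f (V i) = z *\<^sub>C V i)"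
  have ex: "\<exists>!f. ?P z f" if "cmod z = 1" for z
  proof (rule toeplitz_universal_property[OF T])
    have "cnj z * z = 1" "z * cnj z = 1"
      using that complex_norm_square[of z] by (simp_all add: mult.commute)
    then show "star (z *\<^sub>C V i) * (z *\<^sub>C V j) = (if i = j then 1 else 0)" for i j
      using toeplitz_relations(2)[OF T, of i j]
      by (simp add: star_scaleC mult_scaleC_left mult_scaleC_right scaleC_scaleC)
    show "\<iota> a * z *\<^sub>C V i = z *\<^sub>C V i * \<iota> (\<alpha> i a)" for a i
      using toeplitz_relations(3)[OF T, of a i] by (simp add: mult_scaleC_left mult_scaleC_right)
  qed (rule toeplitz_relations(1)[OF T])
  obtain f where f: "?P z f" using ex[OF assms(2)] by blast
  obtain g where g: "?P (cnj z) g" using ex[of "cnj z"] assms(2) by auto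
  have zz: "cnj z * z = 1" "z * cnj z = 1"
    using assms(2) complex_norm_square[of z] by (simp_all add: mult.commute)
  have id: "unital_star_hom (\<lambda>x. x)" by (simp add: unital_star_hom_def)
  have comp: "unital_star_hom (\<lambda>x. h (k x))" if "unital_star_hom h" "unital_star_hom k"
    for h k :: "'t \<Rightarrow> 't"
    using that by (simp add: unital_star_hom_def)
  have P1: "?P 1 (\<lambda>x. x)" using id by simp
  have "?P 1 (\<lambda>x. g (f x))" "?P 1 (\<lambda>x. f (g x))"
    using f g comp zz by (auto simp: unital_star_homD(2) scaleC_scaleC)
  moreover obtain k where "\<And>h. ?P 1 h \<Longrightarrow> h = k"
    using ex[OF norm_one] by (elim ex1E) blast
  ultimately have "(\<lambda>x. g (f x)) = (\<lambda>x. x)" "(\<lambda>x. f (g x)) = (\<lambda>x. x)"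
    using P1 by (metis (no_types, lifting))+
  then have "bij f" by (intro o_bij[of g f]) (auto simp: fun_eq_iff)
  with f ex[OF assms(2)] show ?thesis by blast
qed

definition gauge ::
  "('a::unital_cstar_algebra \<Rightarrow> 't::unital_cstar_algebra) \<Rightarrow> ('d \<Rightarrow> 't) \<Rightarrow> complex \<Rightarrow> 't \<Rightarrow> 't" where
  "gauge \<iota> V z = (THE f. unital_star_hom f \<and> bij f \<and>
                       (\<forall>a. f (\<iota> a) = \<iota> a) \<and> (\<forall>i. f (V i) = z *\<^sub>C V i))"

definition gauge_flow ::
  "('a::unital_cstar_algebra \<Rightarrow> 't::unital_cstar_algebra) \<Rightarrow> ('d \<Rightarrow> 't) \<Rightarrow> real \<Rightarrow> 't \<Rightarrow> 't" where
  "gauge_flow \<iota> V t = gauge \<iota> V (cis t)"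

end

theory Submission
  imports Defs "HOL-Complex_Analysis.Conformal_Mappings"
begin

text \<open>
  A trace \<open>\<tau>\<close> turns the finitely supported sections of the Fock module \<open>\<ell>\<^sup>2(\<F>\<^sub>+\<^sup>d) \<otimes> A\<close>
  into a semi-inner product space on which the free *-algebra acts, and the operator norm is a
  C*-seminorm that vanishes on the relators. Hence vector states descend to
  \<open>\<T>(A,\<alpha>)\<close>: the vector \<open>\<delta>\<^sub>\<emptyset>\<close> gives \<open>\<psi>\<^sub>\<tau>\<close>, and the weights \<open>(1 - d e\<^sup>-\<^sup>\<beta>) e\<^sup>-\<^sup>\<beta>\<^sup>|\<^sup>w\<^sup>|\<close> on the vectors
  \<open>\<delta>\<^sub>w\<close> give a KMS state at distance at most \<open>2 d e\<^sup>-\<^sup>\<beta>\<close> from \<open>\<psi>\<^sub>\<tau>\<close>. Conversely, a KMS state satisfies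
  \<open>\<psi>(x y) = e\<^sup>-\<^sup>n\<^sup>\<beta> \<psi>(y x)\<close> for \<open>x\<close> of gauge degree \<open>n\<close>, which makes it tracial on \<open>A\<close> and bounds it by
  \<open>e\<^sup>-\<^sup>\<beta> \<parallel>a\<parallel>\<close> on \<open>V\<^sub>\<mu> a V\<^sub>\<nu>\<^sup>*\<close> unless \<open>\<mu>\<close> and \<open>\<nu>\<close> are both empty.
\<close>

section \<open>Semidefinite forms and representations of free *-algebras\<close>

text \<open>The norm of the universal algebra is accessible only through its maximality among the
  C*-seminorms that vanish on the relators. Hence every functional is first written down on the free
  *-algebra, where no question of well-definedness arises, and one estimate against
  \<open>norm (ev y)\<close> lets it pass to the algebra. As this takes a seminorm and no Hilbert
  space, null vectors are never divided out and nothing is completed. The factor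
  \<open>1 - d * exp (- \<beta>)\<close> normalizes a geometric series: there are
  \<open>d ^ n\<close> words of length \<open>n\<close>, each of weight
  \<open>exp (- n * \<beta>)\<close>. The series converges once
  \<open>d * exp (- \<beta>) < 1\<close>, which holds for all large \<beta>. The KMS relation of
  these states is checked on single letters: moving \<open>V i\<close> from one side of a product to
  the other shifts the word length by one and costs one factor \<open>exp (- \<beta>)\<close>; for
  elements of A the relation is the trace property. Restriction along \<iota> inverts the map, so
  both directions of the homeomorphism are explicit.\<close>

locale semidefinite_form = vector_space scale
  for scale :: "complex \<Rightarrow> 'h::ab_group_add \<Rightarrow> 'h" +
  fixes form :: "'h \<Rightarrow> 'h \<Rightarrow> complex"
  assumes form_add_left: "form (x + y) z = form x z + form y z"
    and form_add_right: "form x (y + z) = form x y + form x z"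
    and form_scale_left: "form (scale c x) y = cnj c * form x y"
    and form_scale_right: "form x (scale c y) = c * form x y"
    and form_nonneg: "form x x \<in> \<real>\<^sub>\<ge>\<^sub>0"
begin

text \<open>Polarization: the diagonal of the form is real, and its values at \<open>x + y\<close>
  and \<open>x + scale \<i> y\<close> give the imaginary and the real part of the symmetry.\<close>

lemma form_cnj: "form y x = cnj (form x y)"
proof -
  have real: "Im (form z z) = 0" for z
    using form_nonneg[of z] by (simp add: complex_nonneg_Reals_iff)
  have "Im (form x y) + Im (form y x) = 0"
    using real[of "x + y"] real[of x] real[of y] by (simp add: form_add_left form_add_right)
  moreover have "Re (form x y) - Re (form y x) = 0"
    using real[of "x + scale \<i> y"] real[of x] real[of y]
    by (simp add: form_add_left form_add_right form_scale_left form_scale_right)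
  ultimately show ?thesis by (simp add: complex_eq_iff)
qed

definition snorm :: "'h \<Rightarrow> real" where
  "snorm x = sqrt (Re (form x x))"

lemma snorm_nonneg [simp]: "0 \<le> snorm x"
  using form_nonneg[of x] by (simp add: snorm_def complex_nonneg_Reals_iff)

lemma form_self: "form x x = complex_of_real ((snorm x)\<^sup>2)"
  using form_nonneg[of x] by (simp add: snorm_def complex_nonneg_Reals_iff complex_eq_iff)

lemma Cauchy_Schwarz: "cmod (form x y) \<le> snorm x * snorm y"
proof -
  define b where "b = (cmod (form x y))\<^sup>2"
  have b: "form x y * cnj (form x y) = of_real b"
    unfolding b_def by (rule complex_norm_square[symmetric])
  \<comment> \<open>The parameter \<open>t\<close> stays free because \<open>snorm y\<close> may
    vanish: the usual choice is \<open>1 / (snorm y)\<^sup>2\<close>, while for a null vector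
    \<open>y\<close> a large \<open>t\<close> forces \<open>b = 0\<close>.\<close>
  have key: "0 \<le> (snorm x)\<^sup>2 - 2 * t * b + t\<^sup>2 * b * (snorm y)\<^sup>2" for t
  proof -
    define c where "c = - (of_real t * cnj (form x y))"
    have "form (x + scale c y) (x + scale c y) =
        form x x + c * form x y + cnj c * cnj (form x y) + cnj c * c * form y y"
      by (simp add: form_add_left form_add_right form_scale_left form_scale_right
          form_cnj[of y x] algebra_simps)
    also have "\<dots> = of_real ((snorm x)\<^sup>2) - of_real t * (form x y * cnj (form x y))
        - of_real t * (form x y * cnj (form x y))
        + (of_real t)\<^sup>2 * (form x y * cnj (form x y)) * of_real ((snorm y)\<^sup>2)"
      by (simp add: c_def form_self power2_eq_square algebra_simps)
    also have "\<dots> = of_real ((snorm x)\<^sup>2 - 2 * t * b + t\<^sup>2 * b * (snorm y)\<^sup>2)"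
      unfolding b by simp
    finally show ?thesis
      using form_nonneg[of "x + scale c y"] by (simp only: nonneg_Reals_of_real_iff)
  qed
  have "b \<le> (snorm x)\<^sup>2 * (snorm y)\<^sup>2"
  proof (cases "snorm y = 0")
    case True
    show ?thesis
    proof (cases "b = 0")
      case False
      \<comment> \<open>This \<open>t\<close> turns the lower bound into
        \<open>0 \<le> - 1\<close>.\<close>
      then show ?thesis using key[of "((snorm x)\<^sup>2 + 1) / (2 * b)"] True by simp
    qed simp
  next
    case False
    then have pos: "0 < (snorm y)\<^sup>2" by simp
    have bound: "b / s \<le> a" if "s > 0" "0 \<le> a - 2 * (1 / s) * b + (1 / s)\<^sup>2 * b * s" for a s :: real
    proof -
      have "2 * (1 / s) * b - (1 / s)\<^sup>2 * b * s = b / s"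
        using that(1) by (simp add: power2_eq_square)
      then show ?thesis using that(2) by linarith
    qed
    show ?thesis using bound[OF pos key] pos by (simp add: pos_divide_le_eq)
  qed
  then have "(cmod (form x y))\<^sup>2 \<le> (snorm x * snorm y)\<^sup>2"
    by (simp add: b_def power_mult_distrib)
  then show ?thesis by (rule power2_le_imp_le) simp
qed

lemma snorm_triangle: "snorm (x + y) \<le> snorm x + snorm y"
proof -
  have "(snorm (x + y))\<^sup>2 = Re (form (x + y) (x + y))" by (simp add: form_self)
  also have "\<dots> = Re (form x x) + 2 * Re (form x y) + Re (form y y)"
    by (simp add: form_add_left form_add_right form_cnj[of y x])
  also have "\<dots> = (snorm x)\<^sup>2 + 2 * Re (form x y) + (snorm y)\<^sup>2" by (simp add: form_self)
  also have "\<dots> \<le> (snorm x)\<^sup>2 + 2 * (snorm x * snorm y) + (snorm y)\<^sup>2"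
    using Cauchy_Schwarz[of x y] complex_Re_le_cmod[of "form x y"] by linarith
  also have "\<dots> = (snorm x + snorm y)\<^sup>2" by (simp add: power2_sum)
  finally show ?thesis by (rule power2_le_imp_le) simp
qed

lemma snorm_scale: "snorm (scale c x) = cmod c * snorm x"
proof -
  have "complex_of_real ((snorm (scale c x))\<^sup>2) = (c * cnj c) * of_real ((snorm x)\<^sup>2)"
    unfolding form_self[symmetric] by (simp add: form_scale_left form_scale_right)
  also have "\<dots> = of_real ((cmod c * snorm x)\<^sup>2)"
    by (simp add: power_mult_distrib flip: complex_norm_square)
  finally have "(snorm (scale c x))\<^sup>2 = (cmod c * snorm x)\<^sup>2"
    by (simp only: of_real_eq_iff)
  then show ?thesis by simp
qed

end

section \<open>Representations of the free *-algebra and their operator seminorm\<close>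

lemma free_star_free_star: "free_star (free_star a) = a"
  by (induction a rule: free_induct)
    (simp_all add: free_star_add free_star_single word_star_def rev_map case_prod_beta o_def)

locale free_representation = vector_space scale
  for scale :: "complex \<Rightarrow> 'h::ab_group_add \<Rightarrow> 'h" +
  fixes letter_op :: "'g \<times> bool \<Rightarrow> 'h \<Rightarrow> 'h"
  assumes letter_op_add: "letter_op l (x + y) = letter_op l x + letter_op l y"
    and letter_op_scale: "letter_op l (scale c x) = scale c (letter_op l x)"
begin

definition word_op :: "'g star_word \<Rightarrow> 'h \<Rightarrow> 'h" where
  "word_op w x = foldr letter_op (letters w) x"

definition act :: "'g free_star_algebra \<Rightarrow> 'h \<Rightarrow> 'h" where
  "act a x = (\<Sum>w\<in>Poly_Mapping.keys a. scale (Poly_Mapping.lookup a w) (word_op w x))"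

lemma word_op_add: "word_op w (x + y) = word_op w x + word_op w y"
proof -
  have "foldr letter_op l (x + y) = foldr letter_op l x + foldr letter_op l y" for l
    by (induction l) (simp_all add: letter_op_add)
  then show ?thesis by (simp add: word_op_def)
qed

lemma word_op_scale: "word_op w (scale c x) = scale c (word_op w x)"
proof -
  have "foldr letter_op l (scale c x) = scale c (foldr letter_op l x)" for l
    by (induction l) (simp_all add: letter_op_scale)
  then show ?thesis by (simp add: word_op_def)
qed

lemma word_op_plus: "word_op (v + w) x = word_op v (word_op w x)"
  by (simp add: word_op_def plus_star_word_def)

lemma act_single: "act (Poly_Mapping.single w c) x = scale c (word_op w x)"
  by (cases "c = 0") (simp_all add: act_def)

lemma act_add_left: "act (a + b) x = act a x + act b x"
  unfolding act_def by (rule sum_keys_add) (simp_all add: scale_left_distrib)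

lemma act_add: "act a (x + y) = act a x + act a y"
  by (simp add: act_def word_op_add scale_right_distrib sum.distrib)

lemma act_mult: "act (a * b) x = act a (act b x)"
proof (induction a rule: free_induct)
  case (single v c)
  show ?case
  proof (induction b rule: free_induct)
    case (single w c')
    show ?case by (simp add: mult_single act_single word_op_plus word_op_scale)
  qed (simp add: act_add_left act_add distrib_left)
qed (simp add: act_add_left distrib_right)

lemma act_zero: "act 0 x = 0"
  by (simp add: act_def)

lemma act_one: "act 1 x = x"
  using act_single[of 0 1 x] unfolding single_one by (simp add: word_op_def zero_star_word_def)

lemma act_minus: "act (a - b) x = act a x - act b x"
  using act_add_left[of "a - b" b x] by (simp add: algebra_simps)

lemma act_free_scale: "act (free_scale c a) x = scale c (act a x)"
  by (simp add: free_scale_def act_mult act_single word_op_def zero_star_word_def)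

lemma act_gen: "act (gen g) x = letter_op (g, False) x"
  by (simp add: gen_def act_single word_op_def)

lemma act_star_gen: "act (free_star (gen g)) x = letter_op (g, True) x"
  by (simp add: gen_def free_star_single act_single word_op_def word_star_def)

text \<open>Meant for \<open>T\<close> the right multiplication of coefficients by an element of A,
  which commutes with all letters because they act from the left.\<close>

lemma act_commute:
  assumes "\<And>l x. letter_op l (T x) = T (letter_op l x)"
    and "\<And>x y. T (x + y) = T x + T y" and "\<And>c x. T (scale c x) = scale c (T x)"
  shows "act a (T x) = T (act a x)"
proof (induction a rule: free_induct)
  case (single w c)
  have "foldr letter_op l (T x) = T (foldr letter_op l x)" for l
    by (induction l) (simp_all add: assms)
  then show ?case by (simp add: act_single word_op_def assms)
qed (simp add: act_add_left assms)

end

text \<open>Both conditions concern single letters. Adjoints pass to words because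
  \<open>word_star\<close> reverses the word and toggles each flag; bounds pass to all elements
  because these are finite combinations of words.\<close>

locale star_representation =
  free_representation scale letter_op + semidefinite_form scale form
  for scale :: "complex \<Rightarrow> 'h::ab_group_add \<Rightarrow> 'h"
    and letter_op :: "'g \<times> bool \<Rightarrow> 'h \<Rightarrow> 'h"
    and form :: "'h \<Rightarrow> 'h \<Rightarrow> complex" +
  assumes adjoint: "form (letter_op (g, b) x) y = form x (letter_op (g, \<not> b) y)"
    and bounded: "\<exists>C\<ge>0. \<forall>x. snorm (letter_op (g, b) x) \<le> C * snorm x"
begin

lemma word_op_adjoint: "form (word_op w x) y = form x (word_op (word_star w) y)"
proof -
  have "form (foldr letter_op l x) y =
      form x (foldr letter_op (rev (map (\<lambda>(g, b). (g, \<not> b)) l)) y)" for l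
    by (induction l arbitrary: y) (auto simp: adjoint)
  then show ?thesis by (simp add: word_op_def word_star_def)
qed

lemma act_adjoint: "form (act a x) y = form x (act (free_star a) y)"
  by (induction a rule: free_induct)
    (simp_all add: act_add_left form_add_left form_add_right free_star_add free_star_single
      act_single form_scale_left form_scale_right word_op_adjoint)

lemma act_bounded: "\<exists>C\<ge>0. \<forall>x. snorm (act a x) \<le> C * snorm x"
proof (induction a rule: free_induct)
  case (single w c)
  have "\<exists>C\<ge>0. \<forall>x. snorm (foldr letter_op l x) \<le> C * snorm x" for l
  proof (induction l)
    case Nil
    show ?case by (rule exI[of _ 1]) simp
  next
    case (Cons p l)
    obtain C where C: "C \<ge> 0" "\<And>x. snorm (foldr letter_op l x) \<le> C * snorm x"
      using Cons by blast
    obtain C' where C': "C' \<ge> 0" "\<And>x. snorm (letter_op p x) \<le> C' * snorm x"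
      using bounded by (cases p) blast
    have "snorm (foldr letter_op (p # l) x) \<le> (C' * C) * snorm x" for x
      using order_trans[OF C'(2) mult_left_mono[OF C(2) C'(1)]] by (simp add: mult.assoc)
    then show ?case using C(1) C'(1) by (intro exI[of _ "C' * C"]) simp
  qed
  then obtain C where C: "C \<ge> 0" "\<And>x. snorm (word_op w x) \<le> C * snorm x"
    unfolding word_op_def by blast
  have "snorm (act (Poly_Mapping.single w c) x) \<le> (cmod c * C) * snorm x" for x
    using mult_left_mono[OF C(2), of "cmod c" x] by (simp add: act_single snorm_scale mult.assoc)
  then show ?case using C(1) by (intro exI[of _ "cmod c * C"]) simp
next
  case (add a b)
  then obtain C C' where C: "C \<ge> 0" "\<And>x. snorm (act a x) \<le> C * snorm x"
    and C': "C' \<ge> 0" "\<And>x. snorm (act b x) \<le> C' * snorm x" by blast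
  have "snorm (act (a + b) x) \<le> (C + C') * snorm x" for x
    using snorm_triangle[of "act a x" "act b x"] C(2)[of x] C'(2)[of x]
    by (simp add: act_add_left distrib_right)
  then show ?case using C(1) C'(1) by (intro exI[of _ "C + C'"]) simp
qed

text \<open>The infimum of admissible bounds avoids the quotients
  \<open>snorm (act a x) / snorm x\<close>, whose denominators may vanish on nonzero
  vectors.\<close>

definition op_norm :: "'g free_star_algebra \<Rightarrow> real" where
  "op_norm a = Inf {C. 0 \<le> C \<and> (\<forall>x. snorm (act a x) \<le> C * snorm x)}"

lemma op_norm_le: "0 \<le> C \<Longrightarrow> (\<And>x. snorm (act a x) \<le> C * snorm x) \<Longrightarrow> op_norm a \<le> C"
  unfolding op_norm_def by (rule cInf_lower) (auto intro!: bdd_belowI[of _ 0])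

lemma op_norm_nonneg [simp]: "0 \<le> op_norm a"
  unfolding op_norm_def using act_bounded[of a] by (intro cInf_greatest) auto

lemma snorm_act_le: "snorm (act a x) \<le> op_norm a * snorm x"
proof (cases "snorm x = 0")
  case True
  \<comment> \<open>Any finite bound shows that null vectors are mapped to null vectors; dividing by
    \<open>snorm x\<close> is impossible here.\<close>
  obtain C where "\<And>x. snorm (act a x) \<le> C * snorm x" using act_bounded by blast
  from this[of x] show ?thesis using True by simp
next
  case False
  then have pos: "snorm x > 0" using snorm_nonneg[of x] by linarith
  have "snorm (act a x) / snorm x \<le> op_norm a"
    unfolding op_norm_def
    by (rule cInf_greatest) (use act_bounded[of a] pos in \<open>auto simp: field_simps\<close>)
  then show ?thesis using pos by (simp add: field_simps)
qed

lemma form_act_le: "cmod (form x (act a x)) \<le> op_norm a * (snorm x)\<^sup>2"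
  using order_trans[OF Cauchy_Schwarz mult_left_mono[OF snorm_act_le, of "snorm x" a x]]
  by (simp add: power2_eq_square mult.left_commute)

lemma op_norm_eq_0: "(\<And>x. act a x = 0) \<Longrightarrow> op_norm a = 0"
  using op_norm_le[of 0 a] snorm_scale[of 0 0] by (simp add: order_antisym)

lemma op_norm_mult: "op_norm (a * b) \<le> op_norm a * op_norm b"
proof (rule op_norm_le)
  fix x
  have "snorm (act (a * b) x) \<le> op_norm a * (op_norm b * snorm x)"
    unfolding act_mult
    by (rule order_trans[OF snorm_act_le mult_left_mono[OF snorm_act_le]]) simp
  then show "snorm (act (a * b) x) \<le> op_norm a * op_norm b * snorm x" by (simp add: mult.assoc)
qed simp

text \<open>Move one factor to the other side by the adjoint and apply Cauchy-Schwarz. Both the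
  bound on \<open>free_star a\<close> and the C*-identity rest on this.\<close>

lemma snorm_act_square: "(snorm (act a x))\<^sup>2 \<le> snorm x * snorm (act (free_star a * a) x)"
proof -
  have "(snorm (act a x))\<^sup>2 = cmod (form (act a x) (act a x))"
    unfolding form_self norm_of_real by simp
  then show ?thesis by (simp add: act_adjoint Cauchy_Schwarz flip: act_mult)
qed

lemma op_norm_star_le: "op_norm (free_star a) \<le> op_norm a"
proof (rule op_norm_le)
  fix x
  let ?y = "act (free_star a) x"
  have "snorm ?y * snorm ?y \<le> snorm x * snorm (act a ?y)"
    using snorm_act_square[of "free_star a" x]
    by (simp add: free_star_free_star act_mult power2_eq_square)
  also have "\<dots> \<le> snorm x * (op_norm a * snorm ?y)"
    by (rule mult_left_mono[OF snorm_act_le]) simp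
  finally have "snorm ?y * snorm ?y \<le> (op_norm a * snorm x) * snorm ?y" by (simp add: ac_simps)
  then show "snorm ?y \<le> op_norm a * snorm x"
    by (cases "snorm ?y = 0") (simp_all add: mult_le_cancel_right less_le)
qed simp

theorem cstar_seminorm_op_norm: "cstar_seminorm op_norm"
proof -
  have "op_norm (a + b) \<le> op_norm a + op_norm b" for a b
  proof (rule op_norm_le)
    fix x
    show "snorm (act (a + b) x) \<le> (op_norm a + op_norm b) * snorm x"
      using snorm_triangle[of "act a x" "act b x"] snorm_act_le[of a x] snorm_act_le[of b x]
      by (simp add: act_add_left distrib_right)
  qed simp
  moreover have "op_norm (free_scale c a) = cmod c * op_norm a" for c a
  proof -
    have le: "op_norm (free_scale c a) \<le> cmod c * op_norm a" for c a
    proof (rule op_norm_le)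
      show "snorm (act (free_scale c a) x) \<le> cmod c * op_norm a * snorm x" for x
        using mult_left_mono[OF snorm_act_le, of "cmod c" a x]
        by (simp add: act_free_scale snorm_scale mult.assoc)
    qed simp
    show ?thesis
    proof (cases "c = 0")
      case True
      then show ?thesis using le[of 0 a] by (simp add: order_antisym)
    next
      case False
      \<comment> \<open>The reverse inequality is the one already shown, applied to the inverse
        scalar.\<close>
      have "free_scale (inverse c) (free_scale c a) = a"
        using False by (simp add: free_scale_def mult_single flip: mult.assoc)
      then have "op_norm a \<le> inverse (cmod c) * op_norm (free_scale c a)"
        using le[of "inverse c" "free_scale c a"] by (simp add: norm_inverse)
      then show ?thesis using le[of c a] False by (simp add: field_simps)
    qed
  qed
  moreover have "op_norm (free_star a * a) = (op_norm a)\<^sup>2" for a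
  proof (rule antisym)
    have "op_norm (free_star a * a) \<le> op_norm (free_star a) * op_norm a" by (rule op_norm_mult)
    also have "\<dots> \<le> op_norm a * op_norm a" by (rule mult_right_mono[OF op_norm_star_le]) simp
    finally show "op_norm (free_star a * a) \<le> (op_norm a)\<^sup>2" by (simp add: power2_eq_square)
    have "op_norm a \<le> sqrt (op_norm (free_star a * a))"
    proof (rule op_norm_le)
      fix x
      have "(snorm (act a x))\<^sup>2 \<le> snorm x * (op_norm (free_star a * a) * snorm x)"
        by (rule order_trans[OF snorm_act_square mult_left_mono[OF snorm_act_le]]) simp
      also have "\<dots> = (sqrt (op_norm (free_star a * a)) * snorm x)\<^sup>2"
        by (simp add: power_mult_distrib power2_eq_square ac_simps)
      finally show "snorm (act a x) \<le> sqrt (op_norm (free_star a * a)) * snorm x"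
        by (rule power2_le_imp_le) simp
    qed simp
    then show "(op_norm a)\<^sup>2 \<le> op_norm (free_star a * a)"
      using power_mono[of "op_norm a" "sqrt (op_norm (free_star a * a))" 2] by simp
  qed
  ultimately show ?thesis unfolding cstar_seminorm_def by (auto intro: op_norm_mult)
qed

end

section \<open>States\<close>

lemma vector_space_scaleC: "vector_space (scaleC :: complex \<Rightarrow> 'a::unital_cstar_algebra \<Rightarrow> 'a)"
  by unfold_locales (simp_all add: scaleC_add_right scaleC_add_left scaleC_scaleC)

lemma bounded_linear_scaleC_left: "bounded_linear (\<lambda>c. c *\<^sub>C (x::'a::unital_cstar_algebra))"
proof (rule bounded_linear_intro[where K = "norm x"])
  show "(r *\<^sub>R c) *\<^sub>C x = r *\<^sub>R (c *\<^sub>C x)" for r c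
    by (simp add: scaleC_scaleC scaleR_conv_of_real[where 'a = complex] flip: scaleC_of_real)
qed (simp_all add: scaleC_add_left norm_scaleC)

lemma stateI:
  fixes \<phi> :: "'a::unital_cstar_algebra \<Rightarrow> complex"
  assumes add: "\<And>x y. \<phi> (x + y) = \<phi> x + \<phi> y" and scale: "\<And>c x. \<phi> (c *\<^sub>C x) = c * \<phi> x"
    and nonneg: "\<And>x. \<phi> (star x * x) \<in> \<real>\<^sub>\<ge>\<^sub>0"
    and one: "\<phi> 1 = 1" and bound: "\<And>x. cmod (\<phi> x) \<le> norm x"
  shows "state \<phi>"
proof -
  have bl: "bounded_linear \<phi>"
  proof (rule bounded_linear_intro[where K = 1])
    show "\<phi> (r *\<^sub>R x) = r *\<^sub>R \<phi> x" for r x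
      using scale[of "complex_of_real r" x] by (simp add: scaleC_of_real scaleR_conv_of_real)
  qed (simp_all add: add bound)
  have "onorm \<phi> \<le> 1" using bound by (intro onorm_le) simp
  moreover have "1 \<le> onorm \<phi>" using onorm[OF bl, of 1] one by simp
  ultimately show ?thesis using bl scale nonneg by (simp add: state_def)
qed

lemma stateD:
  fixes \<phi> :: "'a::unital_cstar_algebra \<Rightarrow> complex"
  assumes "state \<phi>"
  shows "bounded_linear \<phi>" "\<phi> (x + y) = \<phi> x + \<phi> y" "\<phi> (x - y) = \<phi> x - \<phi> y" "\<phi> 0 = 0"
    "\<phi> (c *\<^sub>C x) = c * \<phi> x" "\<phi> (star x * x) \<in> \<real>\<^sub>\<ge>\<^sub>0" "cmod (\<phi> x) \<le> norm x"
proof -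
  show bl: "bounded_linear \<phi>" and "\<phi> (c *\<^sub>C x) = c * \<phi> x" "\<phi> (star x * x) \<in> \<real>\<^sub>\<ge>\<^sub>0"
    using assms by (auto simp: state_def)
  show "\<phi> (x + y) = \<phi> x + \<phi> y" "\<phi> (x - y) = \<phi> x - \<phi> y" "\<phi> 0 = 0"
    using linear_add linear_diff linear_0 bounded_linear.linear[OF bl] by blast+
  show "cmod (\<phi> x) \<le> norm x"
    using onorm[OF bl, of x] assms by (simp add: state_def)
qed

lemma state_sum: "state \<phi> \<Longrightarrow> \<phi> (\<Sum>i\<in>I. f i) = (\<Sum>i\<in>I. \<phi> (f i))"
  by (rule linear_sum[OF bounded_linear.linear[OF stateD(1)]])

lemma continuous_on_state: "state \<phi> \<Longrightarrow> continuous_on S f \<Longrightarrow> continuous_on S (\<lambda>x. \<phi> (f x))"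
  by (rule bounded_linear.continuous_on[OF stateD(1)])

lemma semidefinite_form_state:
  assumes "state \<phi>"
  shows "semidefinite_form scaleC (\<lambda>x y. \<phi> (star x * y))"
  unfolding semidefinite_form_def semidefinite_form_axioms_def
  by (simp add: vector_space_scaleC star_add star_scaleC distrib_left distrib_right
      mult_scaleC_left mult_scaleC_right stateD[OF assms])

text \<open>States are normalized by \<open>onorm\<close>, so the value at the unit needs an
  argument: Cauchy-Schwarz against the unit gives \<open>onorm \<phi> \<le> snorm 1\<close>, and
  \<open>(snorm 1)\<^sup>2\<close> is the value at 1, which contractivity bounds by 1.\<close>

lemma state_one:
  assumes "state \<phi>"
  shows "\<phi> 1 = 1"
proof -
  interpret semidefinite_form scaleC "\<lambda>x y. \<phi> (star x * y)"
    by (rule semidefinite_form_state[OF assms])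
  have one: "\<phi> 1 = of_real ((snorm 1)\<^sup>2)" using form_self[of 1] by simp
  have "cmod (\<phi> x) \<le> snorm 1 * norm x" for x
  proof -
    have "(snorm x)\<^sup>2 = cmod (\<phi> (star x * x))" by (simp add: form_self norm_power)
    also have "\<dots> \<le> (norm x)\<^sup>2" using stateD(7)[OF assms, of "star x * x"] by (simp add: cstar_identity)
    finally have "snorm x \<le> norm x" by (rule power2_le_imp_le) simp
    then have "snorm 1 * snorm x \<le> snorm 1 * norm x" by (rule mult_left_mono) simp
    then show ?thesis using Cauchy_Schwarz[of 1 x] by simp
  qed
  then have "onorm \<phi> \<le> snorm 1" by (rule onorm_le)
  then have "1 \<le> snorm 1" using assms by (simp add: state_def)
  moreover have "(snorm 1)\<^sup>2 \<le> 1" using stateD(7)[OF assms, of 1] by (simp add: one norm_power)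
  ultimately have "snorm 1 = 1" by (simp add: abs_square_le_1)
  then show ?thesis by (simp add: one)
qed

text \<open>For \<open>r > (norm x)\<^sup>2\<close> the element \<open>r - star x * x\<close> is
  \<open>r\<close> times the square of a self-adjoint \<open>s\<close>, so compressing it by
  \<open>y\<close> gives a nonnegative value. The root exists only under a strict norm bound, hence
  the passage through \<open>e\<close>.\<close>

lemma state_compression_le:
  assumes "state \<phi>"
  shows "Re (\<phi> (star (x * y) * (x * y))) \<le> (norm x)\<^sup>2 * Re (\<phi> (star y * y))"
proof (rule field_le_epsilon)
  fix e :: real
  assume e: "0 < e"
  define C where "C = Re (\<phi> (star y * y))"
  have C: "0 \<le> C" using stateD(6)[OF assms, of y] by (simp add: C_def complex_nonneg_Reals_iff)
  \<comment> \<open>The excess over \<open>(norm x)\<^sup>2\<close> is later multiplied by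
    \<open>C\<close>; dividing by \<open>C + 1\<close> keeps the product below \<open>e\<close> and
    is legitimate when \<open>C = 0\<close>.\<close>
  define r where "r = (norm x)\<^sup>2 + e / (C + 1)"
  have "0 < e / (C + 1)" using e C by simp
  then have r: "(norm x)\<^sup>2 < r" "0 < r" unfolding r_def by (simp, smt (verit) zero_le_power2)
  let ?z = "- ((1 / r) *\<^sub>R (star x * x))"
  have "norm ?z < 1" using r by (simp add: cstar_identity)
  moreover have "star ?z = ?z" by (simp add: star_minus star_scaleR star_mult star_star)
  ultimately obtain s where s: "s * s = 1 + ?z" "star s = s"
    by (rule square_root_exists) blast
  have "r *\<^sub>R (star (s * y) * (s * y)) = r *\<^sub>R (star y * (s * s) * y)"
    by (simp add: star_mult s(2) mult.assoc)
  also have "\<dots> = r *\<^sub>R (star y * y) - star (x * y) * (x * y)"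
    using r(2) by (simp add: s(1) star_mult algebra_simps)
  finally have eq: "\<phi> (r *\<^sub>R (star (s * y) * (s * y))) = \<phi> (r *\<^sub>R (star y * y)) - \<phi> (star (x * y) * (x * y))"
    by (simp add: stateD(3)[OF assms])
  have re: "Re (\<phi> (r *\<^sub>R v)) = r * Re (\<phi> v)" for v
    using stateD(5)[OF assms, of "complex_of_real r" v] by (simp add: scaleC_of_real)
  have "r * Re (\<phi> (star (s * y) * (s * y))) = r * C - Re (\<phi> (star (x * y) * (x * y)))"
    unfolding C_def re[symmetric] eq by simp
  moreover have "0 \<le> r * Re (\<phi> (star (s * y) * (s * y)))"
    using stateD(6)[OF assms, of "s * y"] r(2) by (simp add: complex_nonneg_Reals_iff)
  ultimately have "Re (\<phi> (star (x * y) * (x * y))) \<le> r * C" by simp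
  also have "r * C \<le> (norm x)\<^sup>2 * C + e"
    using e C by (simp add: r_def field_simps)
  finally show "Re (\<phi> (star (x * y) * (x * y))) \<le> (norm x)\<^sup>2 * Re (\<phi> (star y * y)) + e"
    by (simp add: C_def)
qed

lemma universal_cstar_dense:
  assumes "universal_cstar R u" and "closed {y. P y}" and "\<And>x. P (free_eval u x)"
  shows "P y"
  using assms closure_minimal[of "range (free_eval u)" "{y. P y}"]
  by (auto simp: universal_cstar_def)

text \<open>The bound makes \<omega> constant on the fibres of \<open>free_eval u\<close> and
  Lipschitz on its dense range, so it extends by continuity. Linearity, positivity and contractivity
  are closed conditions and hold on the closure.\<close>

lemma universal_cstar_state:
  fixes u :: "'g \<Rightarrow> 'b::unital_cstar_algebra" and \<omega> :: "'g free_star_algebra \<Rightarrow> complex"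
  assumes u: "universal_cstar R u"
    and add: "\<And>x y. \<omega> (x + y) = \<omega> x + \<omega> y" and scale: "\<And>c x. \<omega> (free_scale c x) = c * \<omega> x"
    and nonneg: "\<And>x. \<omega> (free_star x * x) \<in> \<real>\<^sub>\<ge>\<^sub>0" and one: "\<omega> 1 = 1"
    and bound: "\<And>x. cmod (\<omega> x) \<le> norm (free_eval u x)"
  shows "\<exists>\<psi>. state \<psi> \<and> (\<forall>x. \<psi> (free_eval u x) = \<omega> x)"
proof -
  let ?X = "range (free_eval u)"
  have diff: "\<omega> (x - y) = \<omega> x - \<omega> y" for x y
    using add[of "x - y" y] by simp
  have lip: "cmod (\<omega> x - \<omega> y) \<le> norm (free_eval u x - free_eval u y)" for x y
    using bound[of "x - y"] by (simp add: diff free_eval_minus)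
  define f0 where "f0 y = \<omega> (SOME x. free_eval u x = y)" for y
  have f0: "f0 (free_eval u x) = \<omega> x" for x
  proof -
    define x' where "x' = (SOME x'. free_eval u x' = free_eval u x)"
    have "free_eval u x' = free_eval u x" unfolding x'_def by (rule someI) (rule refl)
    then show ?thesis using lip[of x' x] by (simp add: f0_def x'_def)
  qed
  have "uniformly_continuous_on ?X f0"
  proof (rule lipschitz_on_uniformly_continuous[where L = 1], rule lipschitz_onI)
    fix y z assume "y \<in> ?X" "z \<in> ?X"
    then show "dist (f0 y) (f0 z) \<le> 1 * dist y z" using lip by (auto simp: f0 dist_norm)
  qed simp
  then obtain f where "uniformly_continuous_on (closure ?X) f" and f: "\<And>x. x \<in> ?X \<Longrightarrow> f0 x = f x"
    by (rule uniformly_continuous_on_extension_on_closure) blast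
  then have cont: "continuous_on UNIV f"
    using u by (simp add: uniformly_continuous_imp_continuous universal_cstar_def)
  have ev: "f (free_eval u x) = \<omega> x" for x using f[of "free_eval u x"] f0 by simp
  note cf = continuous_on_compose2[OF cont _ subset_UNIV]
  note cont_intros = cf continuous_on_add continuous_on_mult continuous_on_const continuous_on_id
    continuous_on_norm continuous_scaleC continuous_star
  have "state f"
  proof (rule stateI)
    have *: "f (free_eval u x + z) = f (free_eval u x) + f z" for x z
    proof (rule universal_cstar_ext[OF u, where F = "\<lambda>z. f (free_eval u x + z)"])
      show "f (free_eval u x + free_eval u x') = f (free_eval u x) + f (free_eval u x')" for x'
        by (simp add: ev add flip: free_eval_add)
    qed (intro cont_intros)+
    show "f (y + z) = f y + f z" for y z
      by (rule universal_cstar_ext[OF u, where F = "\<lambda>y. f (y + z)"], (intro cont_intros)+) (rule *)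
    show "f (c *\<^sub>C y) = c * f y" for c y
    proof (rule universal_cstar_ext[OF u, where F = "\<lambda>y. f (c *\<^sub>C y)"])
      show "f (c *\<^sub>C free_eval u x) = c * f (free_eval u x)" for x
        by (simp add: ev scale flip: free_eval_scale)
    qed (intro cont_intros)+
    show "f (star y * y) \<in> \<real>\<^sub>\<ge>\<^sub>0" for y
    proof (rule universal_cstar_dense[OF u, where P = "\<lambda>y. f (star y * y) \<in> \<real>\<^sub>\<ge>\<^sub>0"])
      have "continuous_on UNIV (\<lambda>y. f (star y * y))" by (intro cont_intros)
      then have "closed ((\<lambda>y. f (star y * y)) -` \<real>\<^sub>\<ge>\<^sub>0)"
        by (simp add: continuous_on_closed_vimage)
      then show "closed {y. f (star y * y) \<in> \<real>\<^sub>\<ge>\<^sub>0}" by (simp add: vimage_def)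
      show "f (star (free_eval u x) * free_eval u x) \<in> \<real>\<^sub>\<ge>\<^sub>0" for x
        using nonneg[of x] by (simp add: ev flip: free_eval_star free_eval_mult)
    qed
    show "f 1 = 1" using ev[of 1] one by (simp add: free_eval_one)
    show "cmod (f y) \<le> norm y" for y
    proof (rule universal_cstar_dense[OF u, where P = "\<lambda>y. cmod (f y) \<le> norm y"])
      show "closed {y. cmod (f y) \<le> norm y}" by (rule closed_Collect_le) (intro cont_intros)+
    qed (simp add: ev bound)
  qed
  with ev show ?thesis by blast
qed

text \<open>By maximality the universal norm dominates \<open>op_norm\<close>; this replaces an
  extension of the representation to the universal algebra.\<close>

lemma (in star_representation) form_act_le_universal:
  assumes u: "universal_cstar R u"
    and relators: "\<And>r x. r \<in> R \<Longrightarrow> act r x = 0"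
  shows "cmod (form x (act a x)) \<le> norm (free_eval u a) * (snorm x)\<^sup>2"
proof -
  have "\<forall>r\<in>R. op_norm r = 0" using relators op_norm_eq_0 by blast
  then have "op_norm a \<le> norm (free_eval u a)"
    using u cstar_seminorm_op_norm by (simp add: universal_cstar_def)
  then have "op_norm a * (snorm x)\<^sup>2 \<le> norm (free_eval u a) * (snorm x)\<^sup>2"
    by (rule mult_right_mono) simp
  then show ?thesis using form_act_le order_trans by blast
qed

section \<open>The Fock representation\<close>

definition linear_extend ::
  "('w \<Rightarrow> 'a \<Rightarrow> 'b::comm_monoid_add) \<Rightarrow> ('w \<Rightarrow>\<^sub>0 'a::zero) \<Rightarrow> 'b" where
  "linear_extend f \<xi> = (\<Sum>w\<in>Poly_Mapping.keys \<xi>. f w (Poly_Mapping.lookup \<xi> w))"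

lemma linear_extend_single [simp]:
  "f w 0 = 0 \<Longrightarrow> linear_extend f (Poly_Mapping.single w a) = f w a"
  by (cases "a = 0") (simp_all add: linear_extend_def)

lemma linear_extend_add:
  fixes f :: "'w \<Rightarrow> 'a::monoid_add \<Rightarrow> 'b::comm_monoid_add"
  assumes "\<And>w. f w 0 = 0" "\<And>w a b. f w (a + b) = f w a + f w b"
  shows "linear_extend f (\<xi> + \<eta>) = linear_extend f \<xi> + linear_extend f \<eta>"
  unfolding linear_extend_def by (rule sum_keys_add) (fact assms)+

text \<open>
  A finitely supported \<open>\<xi>\<close> represents \<open>\<Sum>\<^sub>w \<delta>\<^sub>w \<otimes> \<xi>(w)\<close> in the Fock module
  \<open>\<ell>\<^sup>2(\<F>\<^sub>+\<^sup>d) \<otimes> A\<close>; no completion is needed for seminorms.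
\<close>

type_synonym ('d, 'a) fock = "'d list \<Rightarrow>\<^sub>0 'a"

definition fock_scale :: "complex \<Rightarrow> ('d, 'a::unital_cstar_algebra) fock \<Rightarrow> ('d, 'a) fock" where
  "fock_scale c = linear_extend (\<lambda>w a. Poly_Mapping.single w (c *\<^sub>C a))"

text \<open>The word \<open>w\<close> stands for \<open>word_prod V w\<close>. Moving
  \<open>a\<close> to the right past its letters applies the endomorphism of the first letter first,
  which is the order of \<open>fold\<close>.\<close>

definition fock_left ::
  "('d \<Rightarrow> 'a::unital_cstar_algebra \<Rightarrow> 'a) \<Rightarrow> 'a \<Rightarrow> ('d, 'a) fock \<Rightarrow> ('d, 'a) fock" where
  "fock_left \<alpha> a = linear_extend (\<lambda>w b. Poly_Mapping.single w (fold \<alpha> w a * b))"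

text \<open>The right A-module structure of the Fock module, untwisted; it serves to commute past
  the left action.\<close>

definition fock_right :: "'a::unital_cstar_algebra \<Rightarrow> ('d, 'a) fock \<Rightarrow> ('d, 'a) fock" where
  "fock_right a = linear_extend (\<lambda>w b. Poly_Mapping.single w (b * a))"

definition creation :: "'d \<Rightarrow> ('d, 'a::unital_cstar_algebra) fock \<Rightarrow> ('d, 'a) fock" where
  "creation i = linear_extend (\<lambda>w. Poly_Mapping.single (i # w))"

definition annihilation :: "'d \<Rightarrow> ('d, 'a::unital_cstar_algebra) fock \<Rightarrow> ('d, 'a) fock" where
  "annihilation i = linear_extend (\<lambda>w a. case w of [] \<Rightarrow> 0
     | j # v \<Rightarrow> if i = j then Poly_Mapping.single v a else 0)"

text \<open>Summing over the support of the second argument makes additivity there an instance of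
  \<open>linear_extend_add\<close>; summands outside that support would vanish.\<close>

definition fock_form ::
  "('a::unital_cstar_algebra \<Rightarrow> complex) \<Rightarrow> ('d, 'a) fock \<Rightarrow> ('d, 'a) fock \<Rightarrow> complex" where
  "fock_form \<tau> \<xi> = linear_extend (\<lambda>w b. \<tau> (star (Poly_Mapping.lookup \<xi> w) * b))"

lemma fock_add:
  "fock_scale c (\<xi> + \<eta>) = fock_scale c \<xi> + fock_scale c \<eta>"
  "fock_left \<alpha> a (\<xi> + \<eta>) = fock_left \<alpha> a \<xi> + fock_left \<alpha> a \<eta>"
  "fock_right a (\<xi> + \<eta>) = fock_right a \<xi> + fock_right a \<eta>"
  "creation i (\<xi> + \<eta>) = creation i \<xi> + creation i \<eta>"
  "annihilation i (\<xi> + \<eta>) = annihilation i \<xi> + annihilation i \<eta>"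
  unfolding fock_scale_def fock_left_def fock_right_def creation_def annihilation_def
  by (rule linear_extend_add;
      simp add: scaleC_add_right distrib_left distrib_right single_add split: list.split)+

lemma fock_single:
  "fock_scale c (Poly_Mapping.single w b) = Poly_Mapping.single w (c *\<^sub>C b)"
  "fock_left \<alpha> a (Poly_Mapping.single w b) = Poly_Mapping.single w (fold \<alpha> w a * b)"
  "fock_right a (Poly_Mapping.single w b) = Poly_Mapping.single w (b * a)"
  "creation i (Poly_Mapping.single w b) = Poly_Mapping.single (i # w) b"
  "annihilation i (Poly_Mapping.single w b) =
     (case w of [] \<Rightarrow> 0 | j # v \<Rightarrow> if i = j then Poly_Mapping.single v b else 0)"
  unfolding fock_scale_def fock_left_def fock_right_def creation_def annihilation_def
  by (subst linear_extend_single; simp split: list.split)+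

lemma fock_lookup:
  "Poly_Mapping.lookup (fock_scale c \<xi>) w = c *\<^sub>C Poly_Mapping.lookup \<xi> w"
  "Poly_Mapping.lookup (fock_left \<alpha> a \<xi>) w = fold \<alpha> w a * Poly_Mapping.lookup \<xi> w"
  "Poly_Mapping.lookup (fock_right a \<xi>) w = Poly_Mapping.lookup \<xi> w * a"
  "Poly_Mapping.lookup (creation i \<xi>) w =
     (case w of [] \<Rightarrow> 0 | j # v \<Rightarrow> if i = j then Poly_Mapping.lookup \<xi> v else 0)"
  "Poly_Mapping.lookup (annihilation i \<xi>) w = Poly_Mapping.lookup \<xi> (i # w)"
  by (induction \<xi> rule: free_induct)
    (auto simp: fock_single fock_add lookup_add lookup_single when_def scaleC_add_right
      distrib_left distrib_right split: list.splits)

definition fock_letter ::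
  "('d \<Rightarrow> 'a::unital_cstar_algebra \<Rightarrow> 'a) \<Rightarrow> ('a + 'd) \<times> bool \<Rightarrow> ('d, 'a) fock \<Rightarrow> ('d, 'a) fock" where
  "fock_letter \<alpha> l = (case l of
      (Inl a, b) \<Rightarrow> fock_left \<alpha> (if b then star a else a)
    | (Inr i, b) \<Rightarrow> if b then annihilation i else creation i)"

lemma vector_space_fock_scale: "vector_space (fock_scale :: complex \<Rightarrow> ('d, 'a::unital_cstar_algebra) fock \<Rightarrow> _)"
  by unfold_locales
    (auto intro!: poly_mapping_eqI
      simp: fock_lookup lookup_add scaleC_add_right scaleC_add_left scaleC_scaleC)

interpretation fock: free_representation fock_scale "fock_letter \<alpha>"
  for \<alpha> :: "'d \<Rightarrow> 'a::unital_cstar_algebra \<Rightarrow> 'a"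
  unfolding free_representation_def free_representation_axioms_def
  by (auto intro!: poly_mapping_eqI
      simp: vector_space_fock_scale fock_letter_def fock_add fock_lookup mult_scaleC_right
      split: sum.split list.split)

lemma unital_star_hom_fold:
  assumes "cstar_system \<alpha>"
  shows "unital_star_hom (fold \<alpha> w)"
proof (induction w)
  case Nil
  show ?case by (simp add: unital_star_hom_def)
next
  case (Cons i w)
  moreover have "unital_star_hom (\<alpha> i)" using assms by (simp add: cstar_system_def)
  ultimately show ?case by (simp add: unital_star_hom_def)
qed

text \<open>Compared coefficient by coefficient. The covariance relator comes down to
  \<open>fold \<alpha> (i # v) a = fold \<alpha> v (\<alpha> i a)\<close>, the other relators in A
  to \<open>fold \<alpha> w\<close> being a unital *-homomorphism.\<close>

lemma fock_act_relator:
  assumes \<alpha>: "cstar_system \<alpha>" and "r \<in> toeplitz_relators \<alpha>"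
  shows "fock.act \<alpha> r \<xi> = 0"
proof -
  note hom = unital_star_homD[OF unital_star_hom_fold[OF \<alpha>]]
  note act = fock.act_minus fock.act_add_left fock.act_mult fock.act_free_scale fock.act_one
    fock.act_zero fock.act_gen fock.act_star_gen
  from assms(2) show ?thesis
    by cases
      (auto intro!: poly_mapping_eqI simp: act fock_letter_def fock_lookup lookup_minus lookup_add
        hom distrib_right mult_scaleC_left mult.assoc split: list.split)
qed

lemma fock_form_add: "state \<tau> \<Longrightarrow> fock_form \<tau> \<xi> (\<eta> + \<zeta>) = fock_form \<tau> \<xi> \<eta> + fock_form \<tau> \<xi> \<zeta>"
  unfolding fock_form_def by (rule linear_extend_add) (simp_all add: stateD distrib_left)

lemma fock_form_zero: "fock_form \<tau> \<xi> 0 = 0"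
  by (simp add: fock_form_def linear_extend_def)

lemma fock_form_single:
  "state \<tau> \<Longrightarrow> fock_form \<tau> \<xi> (Poly_Mapping.single w b) = \<tau> (star (Poly_Mapping.lookup \<xi> w) * b)"
  unfolding fock_form_def by (subst linear_extend_single) (simp_all add: stateD)

lemma fock_form_single_left:
  assumes "state \<tau>"
  shows "fock_form \<tau> (Poly_Mapping.single w a) \<eta> = \<tau> (star a * Poly_Mapping.lookup \<eta> w)"
  by (induction \<eta> rule: free_induct)
    (auto simp: assms fock_form_single fock_form_add lookup_single when_def lookup_add distrib_left
      stateD[OF assms])

lemma fock_form_superset:
  assumes "state \<tau>" "finite S" "Poly_Mapping.keys \<eta> \<subseteq> S"
  shows "fock_form \<tau> \<xi> \<eta> = (\<Sum>w\<in>S. \<tau> (star (Poly_Mapping.lookup \<xi> w) * Poly_Mapping.lookup \<eta> w))"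
  unfolding fock_form_def linear_extend_def
  by (rule sum_keys_superset[OF assms(2,3)]) (simp add: stateD[OF assms(1)])

lemma semidefinite_form_fock:
  fixes \<tau> :: "'a::unital_cstar_algebra \<Rightarrow> complex"
  assumes \<tau>: "state \<tau>"
  shows "semidefinite_form (fock_scale :: _ \<Rightarrow> ('d, 'a) fock \<Rightarrow> _) (fock_form \<tau>)"
proof -
  have "fock_form \<tau> (\<xi> + \<eta>) \<zeta> = fock_form \<tau> \<xi> \<zeta> + fock_form \<tau> \<eta> \<zeta>" for \<xi> \<eta> \<zeta> :: "('d, 'a) fock"
    by (simp add: fock_form_def linear_extend_def lookup_add star_add distrib_right stateD[OF \<tau>]
        sum.distrib)
  moreover have "fock_form \<tau> (fock_scale c \<xi>) \<zeta> = cnj c * fock_form \<tau> \<xi> \<zeta>"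
    for c and \<xi> \<zeta> :: "('d, 'a) fock"
    by (simp add: fock_form_def linear_extend_def fock_lookup star_scaleC mult_scaleC_left
        stateD[OF \<tau>] sum_distrib_left)
  moreover have "fock_form \<tau> \<xi> (fock_scale c \<zeta>) = c * fock_form \<tau> \<xi> \<zeta>"
    for c and \<xi> \<zeta> :: "('d, 'a) fock"
    by (induction \<zeta> rule: free_induct)
      (simp_all add: fock_single fock_add fock_form_single[OF \<tau>] fock_form_add[OF \<tau>]
        mult_scaleC_right stateD[OF \<tau>] distrib_left)
  moreover have "fock_form \<tau> \<xi> \<xi> \<in> \<real>\<^sub>\<ge>\<^sub>0" for \<xi> :: "('d, 'a) fock"
    unfolding fock_form_def linear_extend_def complex_nonneg_Reals_iff Re_sum Im_sum
    using stateD(6)[OF \<tau>] by (auto simp: complex_nonneg_Reals_iff intro!: sum_nonneg)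
  ultimately show ?thesis
    unfolding semidefinite_form_def semidefinite_form_axioms_def
    by (simp add: vector_space_fock_scale fock_form_add[OF \<tau>])
qed

text \<open>The left action is diagonal in the words, so the compression inequality applies to each
  word, with \<open>fold \<alpha> w\<close> contractive.\<close>

lemma fock_form_left_le:
  assumes \<alpha>: "cstar_system \<alpha>" and \<tau>: "state \<tau>"
  shows "Re (fock_form \<tau> (fock_left \<alpha> a \<xi>) (fock_left \<alpha> a \<xi>)) \<le> (norm a)\<^sup>2 * Re (fock_form \<tau> \<xi> \<xi>)"
proof -
  let ?S = "Poly_Mapping.keys \<xi>" and ?x = "Poly_Mapping.lookup \<xi>"
  have "Poly_Mapping.keys (fock_left \<alpha> a \<xi>) \<subseteq> ?S"
    by (auto simp: in_keys_iff fock_lookup)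
  then have "Re (fock_form \<tau> (fock_left \<alpha> a \<xi>) (fock_left \<alpha> a \<xi>)) =
      (\<Sum>w\<in>?S. Re (\<tau> (star (fold \<alpha> w a * ?x w) * (fold \<alpha> w a * ?x w))))"
    by (simp add: fock_form_superset[OF \<tau> finite_keys] fock_lookup)
  also have "\<dots> \<le> (\<Sum>w\<in>?S. (norm a)\<^sup>2 * Re (\<tau> (star (?x w) * ?x w)))"
  proof (rule sum_mono)
    fix w
    have "Re (\<tau> (star (fold \<alpha> w a * ?x w) * (fold \<alpha> w a * ?x w)))
        \<le> (norm (fold \<alpha> w a))\<^sup>2 * Re (\<tau> (star (?x w) * ?x w))"
      by (rule state_compression_le[OF \<tau>])
    also have "\<dots> \<le> (norm a)\<^sup>2 * Re (\<tau> (star (?x w) * ?x w))"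
      using stateD(6)[OF \<tau>, of "?x w"]
      by (intro mult_right_mono power_mono star_hom_contractive[OF unital_star_hom_fold[OF \<alpha>]])
        (auto simp: complex_nonneg_Reals_iff)
    finally show "Re (\<tau> (star (fold \<alpha> w a * ?x w) * (fold \<alpha> w a * ?x w)))
        \<le> (norm a)\<^sup>2 * Re (\<tau> (star (?x w) * ?x w))" .
  qed
  also have "\<dots> = (norm a)\<^sup>2 * Re (fock_form \<tau> \<xi> \<xi>)"
    by (simp add: fock_form_superset[OF \<tau> finite_keys order_refl] sum_distrib_left)
  finally show ?thesis .
qed

lemma star_representation_fock:
  fixes \<alpha> :: "'d::finite \<Rightarrow> 'a::unital_cstar_algebra \<Rightarrow> 'a"
  assumes \<alpha>: "cstar_system \<alpha>" and \<tau>: "state \<tau>"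
  shows "star_representation fock_scale (fock_letter \<alpha>) (fock_form \<tau>)"
proof -
  interpret semidefinite_form "fock_scale :: _ \<Rightarrow> ('d, 'a) fock \<Rightarrow> _" "fock_form \<tau>"
    by (rule semidefinite_form_fock[OF \<tau>])
  note hom = unital_star_homD[OF unital_star_hom_fold[OF \<alpha>]]
  have left: "fock_form \<tau> (fock_left \<alpha> a \<xi>) \<eta> = fock_form \<tau> \<xi> (fock_left \<alpha> (star a) \<eta>)" for a \<xi> \<eta>
    by (induction \<eta> rule: free_induct)
      (simp_all add: fock_single fock_add fock_form_single[OF \<tau>] fock_form_add[OF \<tau>] fock_lookup
        star_mult hom mult.assoc)
  have cre: "fock_form \<tau> (creation i \<xi>) \<eta> = fock_form \<tau> \<xi> (annihilation i \<eta>)" for i and \<xi> \<eta> :: "('d, 'a) fock"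
    by (induction \<eta> rule: free_induct)
      (auto simp: fock_single fock_add fock_form_single[OF \<tau>] fock_form_add[OF \<tau>] fock_lookup
        stateD[OF \<tau>] fock_form_zero split: list.split)
  have ann: "fock_form \<tau> (annihilation i \<xi>) \<eta> = fock_form \<tau> \<xi> (creation i \<eta>)" for i and \<xi> \<eta> :: "('d, 'a) fock"
    using cre[of i \<eta> \<xi>] form_cnj[of \<xi> "creation i \<eta>"] form_cnj[of "annihilation i \<xi>" \<eta>] by simp
  have ann_cre: "annihilation i (creation i \<xi>) = \<xi>" for i and \<xi> :: "('d, 'a) fock"
    by (rule poly_mapping_eqI) (simp add: fock_lookup)
  have snorm_cre: "snorm (creation i \<xi>) = snorm \<xi>" for i \<xi>
    by (simp add: snorm_def cre ann_cre)
  have "\<exists>C\<ge>0. \<forall>\<xi>. snorm (fock_letter \<alpha> (g, b) \<xi>) \<le> C * snorm \<xi>" for g b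
  proof (cases g)
    case (Inl a)
    have "snorm (fock_left \<alpha> c \<xi>) \<le> norm c * snorm \<xi>" for c \<xi>
      using real_sqrt_le_mono[OF fock_form_left_le[OF \<alpha> \<tau>, of c \<xi>]]
      by (simp add: snorm_def real_sqrt_mult)
    then show ?thesis
      by (intro exI[of _ "norm a"]) (auto simp: Inl fock_letter_def norm_star, metis norm_star)
  next
    case (Inr i)
    \<comment> \<open>The adjoint of an isometry is a contraction: move one of the two factors
      across the form and cancel \<open>snorm ?y\<close>.\<close>
    have "snorm (annihilation i \<xi>) \<le> snorm \<xi>" for \<xi>
    proof -
      let ?y = "annihilation i \<xi>"
      have "snorm ?y * snorm ?y = cmod (fock_form \<tau> \<xi> (creation i ?y))"
        using form_self[of ?y] by (simp add: ann norm_power power2_eq_square norm_mult)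
      also have "\<dots> \<le> snorm \<xi> * snorm ?y"
        using Cauchy_Schwarz[of \<xi> "creation i ?y"] by (simp add: snorm_cre)
      finally show ?thesis
        by (cases "snorm ?y = 0") (simp_all add: mult_le_cancel_right less_le)
    qed
    then show ?thesis by (intro exI[of _ 1]) (auto simp: Inr fock_letter_def snorm_cre)
  qed
  moreover have "fock_form \<tau> (fock_letter \<alpha> (g, b) \<xi>) \<eta> = fock_form \<tau> \<xi> (fock_letter \<alpha> (g, \<not> b) \<eta>)"
    for g b \<xi> \<eta>
    by (auto simp: fock_letter_def left cre ann star_star split: sum.split)
  ultimately show ?thesis
    by (intro star_representation.intro star_representation_axioms.intro
        fock.free_representation_axioms semidefinite_form_axioms)
qed

section \<open>Gibbs states\<close>

text \<open>Starred generators are included, so that every word is a product of letters and the KMS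
  relation can be proved by induction on words.\<close>

definition letter :: "'g \<times> bool \<Rightarrow> 'g free_star_algebra" where
  "letter l = Poly_Mapping.single (Word [l]) 1"

lemma act_letter: "fock.act \<alpha> (letter l) \<xi> = fock_letter \<alpha> l \<xi>"
  by (simp add: letter_def fock.act_single fock.word_op_def fock.scale_one)

lemma fock_act_right: "fock.act \<alpha> y (fock_right c \<xi>) = fock_right c (fock.act \<alpha> y \<xi>)"
  by (rule fock.act_commute)
    (auto intro!: poly_mapping_eqI simp: fock_letter_def fock_lookup fock_add mult.assoc
      mult_scaleC_left split: sum.split list.split)

text \<open>The A-valued diagonal matrix coefficient of \<open>y\<close> at the basis vector of
  \<open>w\<close>; followed by a state of A it is a vector state.\<close>

definition fock_diag ::
  "('d \<Rightarrow> 'a::unital_cstar_algebra \<Rightarrow> 'a) \<Rightarrow> 'd list \<Rightarrow> ('a + 'd) free_star_algebra \<Rightarrow> 'a" where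
  "fock_diag \<alpha> w y = Poly_Mapping.lookup (fock.act \<alpha> y (Poly_Mapping.single w 1)) w"

lemma fock_diag_simps:
  "fock_diag \<alpha> w (x + y) = fock_diag \<alpha> w x + fock_diag \<alpha> w y"
  "fock_diag \<alpha> w (free_scale c y) = c *\<^sub>C fock_diag \<alpha> w y"
  "fock_diag \<alpha> w 1 = 1"
  by (simp_all add: fock_diag_def fock.act_add_left fock.act_free_scale fock.act_one lookup_add
      fock_lookup)

text \<open>On the basis vector of \<open>w\<close>, whose coefficient is 1, left and right
  multiplication by \<open>fold \<alpha> w (c a b)\<close> agree, and right multiplication commutes
  with \<open>y\<close>.\<close>

lemma fock_diag_letter_Inl:
  fixes \<alpha> :: "'d \<Rightarrow> 'a::unital_cstar_algebra \<Rightarrow> 'a"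
  defines "c \<equiv> \<lambda>a b. if b then star a else a"
  shows "fock_diag \<alpha> w (letter (Inl a, b) * y) = fold \<alpha> w (c a b) * fock_diag \<alpha> w y"
    and "fock_diag \<alpha> w (y * letter (Inl a, b)) = fock_diag \<alpha> w y * fold \<alpha> w (c a b)"
proof -
  show "fock_diag \<alpha> w (letter (Inl a, b) * y) = fold \<alpha> w (c a b) * fock_diag \<alpha> w y"
    by (simp add: fock_diag_def fock.act_mult act_letter fock_letter_def fock_lookup c_def)
  have "fock_letter \<alpha> (Inl a, b) (Poly_Mapping.single w 1) =
      fock_right (fold \<alpha> w (c a b)) (Poly_Mapping.single w 1)"
    by (simp add: fock_letter_def fock_single c_def)
  then show "fock_diag \<alpha> w (y * letter (Inl a, b)) = fock_diag \<alpha> w y * fold \<alpha> w (c a b)"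
    by (simp add: fock_diag_def fock.act_mult act_letter fock_act_right fock_lookup)
qed

text \<open>Creation by \<open>i\<close> sends the basis vector of \<open>w\<close> to that of
  \<open>i # w\<close>, so the coefficient at \<open>j # w\<close> after a creation is read off at
  \<open>w\<close>, and only for \<open>i = j\<close>. The empty word is not in the range of any
  creation operator and is killed by every annihilation operator.\<close>

lemma fock_diag_letter_Inr:
  "fock_diag \<alpha> [] (letter (Inr i, False) * y) = 0"
  "fock_diag \<alpha> (j # w) (letter (Inr i, False) * y) =
     (if i = j then fock_diag \<alpha> w (y * letter (Inr i, False)) else 0)"
  "fock_diag \<alpha> [] (y * letter (Inr i, True)) = 0"
  "fock_diag \<alpha> (j # w) (y * letter (Inr i, True)) =
     (if i = j then fock_diag \<alpha> w (letter (Inr i, True) * y) else 0)"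
proof -
  have "fock.act \<alpha> y 0 = 0" using fock.act_add[of \<alpha> y 0 0] by simp
  then show "fock_diag \<alpha> [] (letter (Inr i, False) * y) = 0"
    "fock_diag \<alpha> (j # w) (letter (Inr i, False) * y) =
     (if i = j then fock_diag \<alpha> w (y * letter (Inr i, False)) else 0)"
    "fock_diag \<alpha> [] (y * letter (Inr i, True)) = 0"
    "fock_diag \<alpha> (j # w) (y * letter (Inr i, True)) =
     (if i = j then fock_diag \<alpha> w (letter (Inr i, True) * y) else 0)"
    by (auto simp: fock_diag_def fock.act_mult act_letter fock_letter_def fock_lookup fock_single)
qed

lemma finite_words [simp]: "finite {w :: 'd::finite list. length w = n}"
  using finite_lists_length_eq[of "UNIV :: 'd set" n] by simp

lemma card_words: "card {w :: 'd::finite list. length w = n} = CARD('d) ^ n"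
  using card_lists_length_eq[of "UNIV :: 'd set" n] by simp

lemma sum_words_Suc:
  "(\<Sum>w | length w = Suc n. g w) = (\<Sum>j::'d::finite\<in>UNIV. \<Sum>w | length w = n. g (j # w))"
proof -
  have eq: "{w :: 'd list. length w = Suc n} = (\<lambda>(j, w). j # w) ` (UNIV \<times> {w. length w = n})"
    by (auto simp: length_Suc_conv image_iff)
  show ?thesis
    unfolding eq by (subst sum.reindex) (auto simp: inj_on_def sum.cartesian_product o_def case_prod_beta)
qed

text \<open>The A-valued partial trace over the words of length \<open>n\<close>.\<close>

definition fock_level ::
  "('d::finite \<Rightarrow> 'a::unital_cstar_algebra \<Rightarrow> 'a) \<Rightarrow> nat \<Rightarrow> ('a + 'd) free_star_algebra \<Rightarrow> 'a" where
  "fock_level \<alpha> n y = (\<Sum>w | length w = n. fock_diag \<alpha> w y)"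

lemma fock_level_simps:
  fixes \<alpha> :: "'d::finite \<Rightarrow> 'a::unital_cstar_algebra \<Rightarrow> 'a"
  shows "fock_level \<alpha> n (x + y) = fock_level \<alpha> n x + fock_level \<alpha> n y"
    "fock_level \<alpha> n (free_scale c y) = c *\<^sub>C fock_level \<alpha> n y"
    "fock_level \<alpha> n 1 = of_nat (CARD('d) ^ n)"
    "fock_level \<alpha> 0 y = fock_diag \<alpha> [] y"
  by (simp_all add: fock_level_def fock_diag_simps sum.distrib scaleC_sum_right card_words)

text \<open>Split off the first letter of each word of length \<open>Suc n\<close>: only the letter
  \<open>i\<close> contributes, and the remaining words run through level \<open>n\<close>.\<close>

lemma fock_level_letter_Inr:
  "fock_level \<alpha> 0 (letter (Inr i, False) * y) = 0"
  "fock_level \<alpha> (Suc n) (letter (Inr i, False) * y) = fock_level \<alpha> n (y * letter (Inr i, False))"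
  "fock_level \<alpha> 0 (y * letter (Inr i, True)) = 0"
  "fock_level \<alpha> (Suc n) (y * letter (Inr i, True)) = fock_level \<alpha> n (letter (Inr i, True) * y)"
  by (simp_all add: fock_level_def sum_words_Suc fock_diag_letter_Inr if_distrib[of "sum _"]
      sum.delta flip: sum.swap[of _ UNIV])

text \<open>This is where the trace property enters the KMS relation: the two sides differ word by
  word in the order of two factors in A.\<close>

lemma fock_level_letter_Inl:
  assumes "\<tau> \<in> tracial_states"
  shows "\<tau> (fock_level \<alpha> n (letter (Inl a, b) * y)) = \<tau> (fock_level \<alpha> n (y * letter (Inl a, b)))"
  using assms
  by (simp add: fock_level_def fock_diag_letter_Inl state_sum tracial_states_def)

definition letter_degree :: "('a + 'd) \<times> bool \<Rightarrow> int" where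
  "letter_degree l = (case l of (Inl a, b) \<Rightarrow> 0 | (Inr i, b) \<Rightarrow> if b then - 1 else 1)"

definition word_degree :: "('a + 'd) star_word \<Rightarrow> int" where
  "word_degree w = sum_list (map letter_degree (letters w))"

definition gibbs ::
  "('d::finite \<Rightarrow> 'a::unital_cstar_algebra \<Rightarrow> 'a) \<Rightarrow> ('a \<Rightarrow> complex) \<Rightarrow> real \<Rightarrow>
   ('a + 'd) free_star_algebra \<Rightarrow> complex" where
  "gibbs \<alpha> \<tau> r y = complex_of_real (1 - real CARD('d) * r) *
     (suminf (\<lambda>n. complex_of_real (r ^ n) * \<tau> (fock_level \<alpha> n y)))"

locale toeplitz_system =
  fixes \<alpha> :: "'d::finite \<Rightarrow> 'a::unital_cstar_algebra \<Rightarrow> 'a"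
    and \<iota> :: "'a \<Rightarrow> 't::unital_cstar_algebra"
    and V :: "'d \<Rightarrow> 't"
  assumes system: "cstar_system \<alpha>"
    and toeplitz: "toeplitz_algebra \<alpha> \<iota> V"
begin

abbreviation ev :: "('a + 'd) free_star_algebra \<Rightarrow> 't" where
  "ev \<equiv> free_eval (case_sum \<iota> V)"

lemma universal: "universal_cstar (toeplitz_relators \<alpha>) (case_sum \<iota> V)"
  using toeplitz by (simp add: toeplitz_algebra_def)

text \<open>The value is that of the vector state at the basis vector of \<open>w\<close>, which has
  \<open>snorm\<close> one because \<tau> is one at the unit.\<close>

lemma fock_diag_state:
  assumes \<tau>: "state \<tau>"
  shows "cmod (\<tau> (fock_diag \<alpha> w y)) \<le> norm (ev y)"
    and "\<tau> (fock_diag \<alpha> w (free_star y * y)) \<in> \<real>\<^sub>\<ge>\<^sub>0"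
proof -
  interpret star_representation fock_scale "fock_letter \<alpha>" "fock_form \<tau>"
    by (rule star_representation_fock[OF system \<tau>])
  let ?\<delta> = "Poly_Mapping.single w 1"
  have diag: "\<tau> (fock_diag \<alpha> w z) = fock_form \<tau> ?\<delta> (fock.act \<alpha> z ?\<delta>)" for z
    by (simp add: fock_diag_def fock_form_single_left[OF \<tau>])
  have "snorm ?\<delta> = 1"
    by (simp add: snorm_def fock_form_single_left[OF \<tau>] state_one[OF \<tau>])
  then show "cmod (\<tau> (fock_diag \<alpha> w y)) \<le> norm (ev y)"
    using form_act_le_universal[OF universal fock_act_relator[OF system], of ?\<delta> y]
    by (simp add: diag)
  have "free_star (free_star y) = y" by (rule free_star_free_star)
  then show "\<tau> (fock_diag \<alpha> w (free_star y * y)) \<in> \<real>\<^sub>\<ge>\<^sub>0"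
    using form_nonneg[of "fock.act \<alpha> y ?\<delta>"] by (simp add: diag fock.act_mult act_adjoint)
qed

lemma fock_level_bound:
  assumes \<tau>: "state \<tau>"
  shows "cmod (\<tau> (fock_level \<alpha> n y)) \<le> real CARD('d) ^ n * norm (ev y)"
proof -
  have "cmod (\<tau> (fock_level \<alpha> n y)) \<le> (\<Sum>w :: 'd list | length w = n. norm (ev y))"
    unfolding fock_level_def state_sum[OF \<tau>] by (rule sum_norm_le) (rule fock_diag_state[OF \<tau>])
  then show ?thesis by (simp add: card_words)
qed

context
  fixes \<tau> :: "'a \<Rightarrow> complex" and r :: real
  assumes \<tau>: "state \<tau>" and r: "0 \<le> r" "real CARD('d) * r < 1"
begin

lemma gibbs_term_bound:
  "cmod (complex_of_real (r ^ n) * \<tau> (fock_level \<alpha> n y)) \<le> (real CARD('d) * r) ^ n * norm (ev y)"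
  using mult_left_mono[OF fock_level_bound[OF \<tau>, of n y], of "r ^ n"] r
  by (simp add: norm_mult norm_power power_mult_distrib ac_simps)

lemma geometric: "summable (\<lambda>n. (real CARD('d) * r) ^ n * norm (ev y))"
  "(suminf (\<lambda>n. (real CARD('d) * r) ^ n * norm (ev y))) = norm (ev y) / (1 - real CARD('d) * r)"
  using r by (simp_all add: summable_geometric summable_mult2 suminf_mult2[symmetric] suminf_geometric)

lemma gibbs_summable: "summable (\<lambda>n. complex_of_real (r ^ n) * \<tau> (fock_level \<alpha> n y))"
  by (rule summable_comparison_test[OF _ geometric(1)]) (use gibbs_term_bound in blast)

lemma gibbs_linear:
  "gibbs \<alpha> \<tau> r (x + y) = gibbs \<alpha> \<tau> r x + gibbs \<alpha> \<tau> r y"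
  "gibbs \<alpha> \<tau> r (free_scale c y) = c * gibbs \<alpha> \<tau> r y"
proof -
  have "suminf (\<lambda>n. complex_of_real (r ^ n) * \<tau> (fock_level \<alpha> n (x + y))) =
      suminf (\<lambda>n. complex_of_real (r ^ n) * \<tau> (fock_level \<alpha> n x)) +
      suminf (\<lambda>n. complex_of_real (r ^ n) * \<tau> (fock_level \<alpha> n y))"
    unfolding suminf_add[OF gibbs_summable gibbs_summable]
    by (simp only: fock_level_simps stateD(2)[OF \<tau>] distrib_left)
  then show "gibbs \<alpha> \<tau> r (x + y) = gibbs \<alpha> \<tau> r x + gibbs \<alpha> \<tau> r y"
    by (simp only: gibbs_def distrib_left)
  have "(suminf (\<lambda>n. c * (complex_of_real (r ^ n) * \<tau> (fock_level \<alpha> n y)))) =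
      c * (suminf (\<lambda>n. complex_of_real (r ^ n) * \<tau> (fock_level \<alpha> n y)))"
    by (rule suminf_mult[OF gibbs_summable])
  then show "gibbs \<alpha> \<tau> r (free_scale c y) = c * gibbs \<alpha> \<tau> r y"
    by (simp add: gibbs_def fock_level_simps stateD(5)[OF \<tau>] mult.left_commute)
qed

lemma gibbs_bound: "cmod (gibbs \<alpha> \<tau> r y) \<le> norm (ev y)"
proof -
  have "cmod (suminf (\<lambda>n. complex_of_real (r ^ n) * \<tau> (fock_level \<alpha> n y))) \<le> norm (ev y) / (1 - real CARD('d) * r)"
    unfolding geometric(2)[symmetric]
    by (rule norm_suminf_le) (rule geometric gibbs_term_bound)+
  then have "(1 - real CARD('d) * r) *
      cmod (suminf (\<lambda>n. complex_of_real (r ^ n) * \<tau> (fock_level \<alpha> n y))) \<le> norm (ev y)"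
    using r by (simp add: pos_le_divide_eq mult.commute)
  then show ?thesis
    using r by (simp only: gibbs_def norm_mult norm_of_real abs_of_nonneg diff_ge_0_iff_ge less_imp_le)
qed

lemma gibbs_one: "gibbs \<alpha> \<tau> r 1 = 1"
proof -
  have "\<tau> (of_nat m) = of_nat m" for m
    using stateD(5)[OF \<tau>, of "of_nat m" 1] scaleC_of_real[of "real m" "1::'a"] state_one[OF \<tau>]
    by (simp add: scaleR_conv_of_real)
  then have "(suminf (\<lambda>n. complex_of_real (r ^ n) * \<tau> (fock_level \<alpha> n 1))) =
      (suminf (\<lambda>n. complex_of_real (real CARD('d) * r) ^ n))"
    by (simp add: fock_level_simps power_mult_distrib mult.commute flip: of_nat_power)
  also have "\<dots> = 1 / (1 - complex_of_real (real CARD('d) * r))"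
    using r by (intro suminf_geometric) (simp add: norm_mult)
  finally show ?thesis
    using r by (simp add: gibbs_def) (metis of_real_1 of_real_eq_iff of_real_mult of_real_of_nat_eq less_irrefl)
qed

lemma gibbs_nonneg: "gibbs \<alpha> \<tau> r (free_star y * y) \<in> \<real>\<^sub>\<ge>\<^sub>0"
proof -
  define f where "f n = complex_of_real (r ^ n) * \<tau> (fock_level \<alpha> n (free_star y * y))" for n
  have "\<tau> (fock_level \<alpha> n (free_star y * y)) \<in> \<real>\<^sub>\<ge>\<^sub>0" for n
    unfolding fock_level_def state_sum[OF \<tau>] complex_nonneg_Reals_iff Re_sum Im_sum
    using fock_diag_state(2)[OF \<tau>] by (auto simp: complex_nonneg_Reals_iff intro!: sum_nonneg)
  then have "f n \<in> \<real>\<^sub>\<ge>\<^sub>0" for n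
    unfolding f_def using r by (intro nonneg_Reals_mult_I) simp_all
  moreover have "summable f" unfolding f_def by (rule gibbs_summable)
  ultimately have "suminf f \<in> \<real>\<^sub>\<ge>\<^sub>0"
    using suminf_nonneg[OF summable_Re, of f]
    by (auto simp: Re_suminf Im_suminf complex_nonneg_Reals_iff)
  moreover have "gibbs \<alpha> \<tau> r (free_star y * y) = of_real (1 - real CARD('d) * r) * suminf f"
    by (simp add: gibbs_def f_def[abs_def])
  moreover have "complex_of_real (1 - real CARD('d) * r) \<in> \<real>\<^sub>\<ge>\<^sub>0"
    using r unfolding nonneg_Reals_of_real_iff by simp
  ultimately show ?thesis by (metis nonneg_Reals_mult_I)
qed

lemma gibbs_state: "\<exists>\<psi>. state \<psi> \<and> (\<forall>y. \<psi> (ev y) = gibbs \<alpha> \<tau> r y)"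
  by (rule universal_cstar_state[OF universal gibbs_linear gibbs_nonneg gibbs_one gibbs_bound])

lemma gibbs_vacuum:
  "cmod (gibbs \<alpha> \<tau> r y - \<tau> (fock_diag \<alpha> [] y)) \<le> 2 * (real CARD('d) * r) * norm (ev y)"
proof -
  define q where "q = real CARD('d) * r"
  let ?f = "\<lambda>n. complex_of_real (r ^ n) * \<tau> (fock_level \<alpha> n y)"
  have q: "0 \<le> q" "q < 1" using r by (simp_all add: q_def)
  have "cmod (suminf (\<lambda>n. ?f (Suc n))) \<le> suminf (\<lambda>n. q ^ n * (q * norm (ev y)))"
  proof (rule norm_suminf_le)
    show "summable (\<lambda>n. q ^ n * (q * norm (ev y)))"
      using q by (intro summable_mult2 summable_geometric) simp
    show "cmod (?f (Suc n)) \<le> q ^ n * (q * norm (ev y))" for n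
      using gibbs_term_bound[of "Suc n" y] by (simp only: q_def power_Suc2 mult.assoc)
  qed
  also have "suminf (\<lambda>n. q ^ n * (q * norm (ev y))) = 1 / (1 - q) * (q * norm (ev y))"
    using q by (subst suminf_mult2[symmetric]) (simp_all add: summable_geometric suminf_geometric)
  finally have "cmod (suminf (\<lambda>n. ?f (Suc n))) \<le> q * norm (ev y) / (1 - q)" by simp
  moreover define S where "S = suminf (\<lambda>n. ?f (Suc n))"
  ultimately have tail: "cmod S * (1 - q) \<le> q * norm (ev y)"
    using q by (simp add: pos_le_divide_eq)
  define t where "t = \<tau> (fock_diag \<alpha> [] y)"
  have t: "cmod t \<le> norm (ev y)" unfolding t_def by (rule fock_diag_state(1)[OF \<tau>])
  have "suminf ?f = t + S"
    using suminf_split_head[OF gibbs_summable, of y] unfolding S_def t_def fock_level_simps by simp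
  \<comment> \<open>The factor \<open>1 - q\<close> cancels the denominator in the bound on the tail
    \<open>S\<close>, so each of the two terms is at most \<open>q * norm (ev y)\<close>; hence the
    constant 2.\<close>
  then have "gibbs \<alpha> \<tau> r y - t = of_real (1 - q) * S - of_real q * t"
    unfolding gibbs_def q_def[symmetric] by (simp add: algebra_simps)
  then have "cmod (gibbs \<alpha> \<tau> r y - t) \<le> cmod (of_real (1 - q) * S) + cmod (of_real q * t)"
    by (simp only: norm_triangle_ineq4)
  also have "\<dots> = cmod S * (1 - q) + q * cmod t"
    using q by (simp only: norm_mult norm_of_real abs_of_nonneg diff_ge_0_iff_ge less_imp_le mult.commute)
  also have "\<dots> \<le> q * norm (ev y) + q * norm (ev y)"
    using tail mult_left_mono[OF t q(1)] by linarith
  finally show ?thesis by (simp add: q_def t_def ac_simps)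
qed

end

lemma gibbs_letter:
  assumes \<tau>: "\<tau> \<in> tracial_states" and \<beta>: "real CARD('d) * exp (- \<beta>) < 1"
  shows "gibbs \<alpha> \<tau> (exp (- \<beta>)) (letter l * y) =
    of_real (exp (- \<beta> * letter_degree l)) * gibbs \<alpha> \<tau> (exp (- \<beta>)) (y * letter l)"
proof -
  have st: "state \<tau>" using \<tau> by (simp add: tracial_states_def)
  note summ = gibbs_summable[OF st _ \<beta>]
  \<comment> \<open>Level 0 drops out and reindexing the series pulls out one weight. For a starred
    letter the roles of the two products are exchanged, so the resulting equation has to be inverted
    with \<open>exp \<beta>\<close>.\<close>
  have shift: "gibbs \<alpha> \<tau> (exp (- \<beta>)) x = of_real (exp (- \<beta>)) * gibbs \<alpha> \<tau> (exp (- \<beta>)) z"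
    if "fock_level \<alpha> 0 x = 0" "\<And>n. fock_level \<alpha> (Suc n) x = fock_level \<alpha> n z" for x z
  proof -
    let ?f = "\<lambda>x n. complex_of_real (exp (- \<beta>) ^ n) * \<tau> (fock_level \<alpha> n x)"
    have "suminf (?f x) = (suminf (\<lambda>n. ?f x (Suc n)))"
      using suminf_split_head[OF summ, of x] that(1) stateD(4)[OF st] by simp
    also have "\<dots> = (suminf (\<lambda>n. complex_of_real (exp (- \<beta>)) * ?f z n))"
      by (simp add: that(2) mult.assoc)
    also have "\<dots> = complex_of_real (exp (- \<beta>)) * suminf (?f z)"
      by (rule suminf_mult[OF summ]) simp
    finally show ?thesis by (simp add: gibbs_def)
  qed
  obtain g b where l: "l = (g, b)" by (cases l)
  show ?thesis
  proof (cases g)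
    case (Inl a)
    then show ?thesis
      by (simp add: l letter_degree_def gibbs_def fock_level_letter_Inl[OF \<tau>])
  next
    case (Inr i)
    show ?thesis
    proof (cases b)
      case True
      have "gibbs \<alpha> \<tau> (exp (- \<beta>)) (y * letter l) =
          of_real (exp (- \<beta>)) * gibbs \<alpha> \<tau> (exp (- \<beta>)) (letter l * y)"
        by (rule shift) (simp_all add: l Inr True fock_level_letter_Inr)
      moreover have "complex_of_real (exp \<beta>) * complex_of_real (exp (- \<beta>)) = 1"
        by (simp flip: of_real_mult exp_add)
      ultimately show ?thesis
        by (simp add: l Inr True letter_degree_def flip: mult.assoc)
    next
      case False
      have "gibbs \<alpha> \<tau> (exp (- \<beta>)) (letter l * y) =
          of_real (exp (- \<beta>)) * gibbs \<alpha> \<tau> (exp (- \<beta>)) (y * letter l)"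
        by (rule shift) (simp_all add: l Inr False fock_level_letter_Inr)
      then show ?thesis by (simp add: l Inr False letter_degree_def)
    qed
  qed
qed

text \<open>The letters are moved cyclically one at a time, and their degrees add up. A moved letter
  joins the other factor, so the induction runs over arbitrary \<open>y\<close>.\<close>

lemma gibbs_word:
  assumes "\<tau> \<in> tracial_states" and "real CARD('d) * exp (- \<beta>) < 1"
  shows "gibbs \<alpha> \<tau> (exp (- \<beta>)) (Poly_Mapping.single w 1 * y) =
    of_real (exp (- \<beta> * word_degree w)) * gibbs \<alpha> \<tau> (exp (- \<beta>)) (y * Poly_Mapping.single w 1)"
proof -
  have "gibbs \<alpha> \<tau> (exp (- \<beta>)) (Poly_Mapping.single (Word ls) 1 * y) =
    of_real (exp (- \<beta> * (\<Sum>l\<leftarrow>ls. letter_degree l))) *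
      gibbs \<alpha> \<tau> (exp (- \<beta>)) (y * Poly_Mapping.single (Word ls) 1)" for ls y
  proof (induction ls arbitrary: y)
    case Nil
    have "Poly_Mapping.single (Word []) 1 = (1 :: ('a + 'd) free_star_algebra)"
      by (simp add: single_one flip: zero_star_word_def)
    then show ?case by simp
  next
    case (Cons l ls)
    let ?s = "Poly_Mapping.single (Word ls) (1::complex)"
    have *: "Poly_Mapping.single (Word (l # ls)) 1 = letter l * ?s"
      by (simp add: letter_def mult_single plus_star_word_def)
    show ?case
      unfolding * mult.assoc gibbs_letter[OF assms, of l "?s * y"] Cons[of "y * letter l"]
      by (simp add: distrib_left exp_diff exp_minus field_simps)
  qed
  from this[of "letters w" y] show ?thesis by (simp add: word_degree_def)
qed

end

section \<open>KMS states of the gauge flow\<close>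

text \<open>Needed because \<open>kms_state\<close> quantifies over every entire extension of an
  orbit: after applying a state, all extensions agree at imaginary arguments too.\<close>

lemma entire_functions_eq_on_reals:
  assumes "f holomorphic_on UNIV" "g holomorphic_on UNIV"
    and "\<And>t. f (complex_of_real t) = g (complex_of_real t)"
  shows "f z = g z"
proof -
  have "(0::complex) islimpt range complex_of_real"
    unfolding islimpt_approachable
  proof (intro allI impI)
    fix e :: real assume "e > 0"
    then show "\<exists>x'\<in>range complex_of_real. x' \<noteq> 0 \<and> dist x' 0 < e"
      by (intro bexI[of _ "complex_of_real (e / 2)"] conjI rangeI) (simp_all add: norm_divide)
  qed
  moreover have "(\<lambda>z. f z - g z) holomorphic_on UNIV" using assms(1,2) by (rule holomorphic_on_diff)
  ultimately have "f z - g z = 0"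
    by - (rule analytic_continuation[where f = "\<lambda>z. f z - g z" and U = "range complex_of_real"
          and S = UNIV and \<xi> = 0], auto simp: assms(3))
  then show ?thesis by simp
qed

text \<open>
  Horizontal averages over a period do not depend on the line: both equal the increment of a
  primitive, which is compared with \<open>a\<close> and \<open>b\<close> by the mean value inequality.
\<close>

lemma periodic_entire_lines:
  assumes k: "k holomorphic_on UNIV"
    and per: "\<And>t. k (complex_of_real (t + p)) = k (complex_of_real t)" and p: "p > 0"
    and a: "\<And>t. cmod (k (complex_of_real t + \<zeta>) - a) \<le> e"
    and b: "\<And>t. cmod (k (complex_of_real t) - b) \<le> e'"
  shows "cmod (a - b) \<le> e + e'"
proof -
  obtain P where P: "(P has_field_derivative k z) (at z)" for z
    using holomorphic_convex_primitive'[OF convex_UNIV open_UNIV k] by auto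
  have k': "(\<lambda>z. k (z + of_real p)) holomorphic_on UNIV"
    by (rule holomorphic_on_compose_gen[OF _ k, unfolded o_def]) (auto intro!: holomorphic_intros)
  have per': "k (z + of_real p) = k z" for z
    by (rule entire_functions_eq_on_reals[OF k' k]) (use per in simp)
  define I where "I = P (of_real p) - P 0"
  \<comment> \<open>The derivative in \<open>z\<close> is \<open>k (z + of_real p) - k z\<close>,
    which vanishes on the whole plane since periodicity spreads from the real line by the identity
    theorem.\<close>
  have const: "P (z + of_real p) - P z = I" for z
  proof -
    have "((\<lambda>z. P (z + of_real p) - P z) has_field_derivative 0) (at z within UNIV)" for z
      using DERIV_diff[OF DERIV_shift[THEN iffD1, OF P[of "z + of_real p"]] P[of z]] per'[of z]
      by simp
    then show ?thesis
      using has_field_derivative_zero_constant[of UNIV "\<lambda>z. P (z + of_real p) - P z"]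
      by (auto simp: I_def) (metis add_0)
  qed
  \<comment> \<open>Apply the mean value inequality to \<open>P z - c * z\<close> along one period
    of the horizontal line through \<open>w\<close>.\<close>
  have line: "cmod (I - of_real p * c) \<le> p * \<epsilon>"
    if c: "\<And>t. cmod (k (complex_of_real t + w) - c) \<le> \<epsilon>" for w c \<epsilon>
  proof -
    let ?S = "closed_segment w (w + of_real p)"
    have "cmod ((P (w + of_real p) - c * (w + of_real p)) - (P w - c * w)) \<le> \<epsilon> * cmod (w + of_real p - w)"
    proof (rule field_differentiable_bound[where S = ?S and f' = "\<lambda>z. k z - c"])
      fix z assume z: "z \<in> ?S"
      show "((\<lambda>z. P z - c * z) has_field_derivative k z - c) (at z within ?S)"
        using DERIV_subset[OF P] by (auto intro!: derivative_eq_intros)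
      from z obtain u where "z = (1 - u) *\<^sub>R w + u *\<^sub>R (w + of_real p)"
        by (auto simp: closed_segment_def)
      then have "z = complex_of_real (u * p) + w"
        by (simp add: algebra_simps scaleR_conv_of_real)
      then show "cmod (k z - c) \<le> \<epsilon>" using c[of "u * p"] by simp
    qed auto
    then show ?thesis
      using p const[of w] by (simp add: algebra_simps)
  qed
  have "p * cmod (a - b) = cmod ((I - of_real p * b) - (I - of_real p * a))"
    using p by (simp add: norm_mult flip: right_diff_distrib)
  also have "\<dots> \<le> p * e' + p * e"
    by (rule order_trans[OF norm_triangle_ineq4 add_mono])
      (use line[of 0 b e'] line[of \<zeta> a e] a b in auto)
  also have "\<dots> = p * (e + e')" by (simp add: algebra_simps)
  finally show ?thesis using p by simp
qed

lemma holomorphic_entire_state: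
  assumes f: "entire f" and \<psi>: "state \<psi>"
  shows "(\<lambda>z. \<psi> (y * f z)) holomorphic_on UNIV"
  unfolding holomorphic_on_def field_differentiable_def
proof (intro ballI)
  fix z
  obtain D where D: "((\<lambda>h. inverse h *\<^sub>C (f (z + h) - f z)) \<longlongrightarrow> D) (at 0)"
    using f by (auto simp: entire_def)
  have "((\<lambda>h. \<psi> (y * (inverse h *\<^sub>C (f (z + h) - f z)))) \<longlongrightarrow> \<psi> (y * D)) (at 0)"
    by (intro bounded_linear.tendsto[OF stateD(1)[OF \<psi>]] tendsto_mult tendsto_const D)
  then have "((\<lambda>z. \<psi> (y * f z)) has_field_derivative \<psi> (y * D)) (at z)"
    unfolding DERIV_def
    by (simp add: mult_scaleC_right stateD[OF \<psi>] right_diff_distrib divide_inverse mult.commute)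
  then show "\<exists>f'. ((\<lambda>z. \<psi> (y * f z)) has_field_derivative f') (at z within UNIV)" by auto
qed

lemma entire_scaleC:
  assumes "g holomorphic_on UNIV"
  shows "entire (\<lambda>z. g z *\<^sub>C v)"
  unfolding entire_def
proof
  fix z
  obtain d where "(g has_field_derivative d) (at z)"
    using assms by (auto simp: holomorphic_on_def field_differentiable_def)
  then have "((\<lambda>h. ((g (z + h) - g z) / h) *\<^sub>C v) \<longlongrightarrow> d *\<^sub>C v) (at 0)"
    unfolding DERIV_def by (rule bounded_linear.tendsto[OF bounded_linear_scaleC_left])
  moreover have "((g (z + h) - g z) / h) *\<^sub>C v = inverse h *\<^sub>C (g (z + h) *\<^sub>C v - g z *\<^sub>C v)" for h
  proof -
    have "g (z + h) *\<^sub>C v - g z *\<^sub>C v = (g (z + h) - g z) *\<^sub>C v"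
      using scaleC_add_left[of "g (z + h) - g z" "g z" v] by simp
    then show ?thesis by (simp add: scaleC_scaleC divide_inverse mult.commute)
  qed
  ultimately show "\<exists>D. ((\<lambda>h. inverse h *\<^sub>C (g (z + h) *\<^sub>C v - g z *\<^sub>C v)) \<longlongrightarrow> D) (at 0)" by auto
qed

lemma entire_sum:
  assumes "\<And>i. i \<in> I \<Longrightarrow> entire (f i)"
  shows "entire (\<lambda>z. \<Sum>i\<in>I. f i z)"
  unfolding entire_def
proof
  fix z
  have "\<exists>D. \<forall>i\<in>I. ((\<lambda>h. inverse h *\<^sub>C (f i (z + h) - f i z)) \<longlongrightarrow> D i) (at 0)"
    using assms by (intro bchoice) (auto simp: entire_def)
  then obtain D where "\<And>i. i \<in> I \<Longrightarrow> ((\<lambda>h. inverse h *\<^sub>C (f i (z + h) - f i z)) \<longlongrightarrow> D i) (at 0)"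
    by blast
  then have "((\<lambda>h. \<Sum>i\<in>I. inverse h *\<^sub>C (f i (z + h) - f i z)) \<longlongrightarrow> (\<Sum>i\<in>I. D i)) (at 0)"
    by (rule tendsto_sum)
  then have "((\<lambda>h. inverse h *\<^sub>C ((\<Sum>i\<in>I. f i (z + h)) - (\<Sum>i\<in>I. f i z))) \<longlongrightarrow> (\<Sum>i\<in>I. D i)) (at 0)"
    unfolding sum_subtractf[symmetric] scaleC_sum_right .
  then show "\<exists>D. ((\<lambda>h. inverse h *\<^sub>C ((\<Sum>i\<in>I. f i (z + h)) - (\<Sum>i\<in>I. f i z))) \<longlongrightarrow> D) (at 0)" ..
qed

section \<open>The gauge flow and its homogeneous elements\<close>

context toeplitz_system
begin

abbreviation \<sigma> :: "real \<Rightarrow> 't \<Rightarrow> 't" where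
  "\<sigma> \<equiv> gauge_flow \<iota> V"

lemma flow: "unital_star_hom (\<sigma> t)" "\<sigma> t (\<iota> a) = \<iota> a" "\<sigma> t (V i) = cis t *\<^sub>C V i"
  using theI'[OF gauge_ex1[OF toeplitz norm_cis[of t]]]
  by (auto simp: gauge_flow_def gauge_def)

lemma flow_word_value:
  "\<sigma> t (word_value (case_sum \<iota> V) w) =
     cis (t * word_degree w) *\<^sub>C word_value (case_sum \<iota> V) w"
proof -
  note hom = unital_star_homD[OF flow(1)]
  let ?f = "\<lambda>(g, b). if b then star (case_sum \<iota> V g) else case_sum \<iota> V g"
  have letter: "\<sigma> t (?f l) = cis (t * letter_degree l) *\<^sub>C ?f l" for l
    by (auto simp: letter_degree_def hom flow star_scaleC cis_cnj split: sum.split prod.split)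
  have "\<sigma> t (prod_list (map ?f ls)) =
      cis (t * (\<Sum>l\<leftarrow>ls. letter_degree l)) *\<^sub>C prod_list (map ?f ls)" for ls
    by (induction ls)
      (simp_all add: hom letter mult_scaleC_left mult_scaleC_right scaleC_scaleC cis_mult
        distrib_left add.commute)
  then show ?thesis by (simp add: word_value_def word_degree_def)
qed

lemma flow_add: "\<sigma> s (\<sigma> t x) = \<sigma> (s + t) x"
proof (rule universal_cstar_ext[OF universal, where F = "\<lambda>x. \<sigma> s (\<sigma> t x)"])
  show "continuous_on UNIV (\<lambda>x. \<sigma> s (\<sigma> t x))"
    by (rule continuous_on_compose2[OF continuous_star_hom[OF flow(1), of UNIV]
        continuous_star_hom[OF flow(1)]]) auto
  show "continuous_on UNIV (\<sigma> (s + t))" by (rule continuous_star_hom[OF flow(1)])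
  note hom = unital_star_homD[OF flow(1)]
  show "\<sigma> s (\<sigma> t (ev y)) = \<sigma> (s + t) (ev y)" for y
    by (induction y rule: free_induct)
      (simp_all add: free_eval_single free_eval_add hom flow_word_value scaleC_scaleC
        distrib_right ac_simps flip: cis_mult)
qed

text \<open>
  The subalgebra \<open>D\<close> of the KMS condition need not contain \<open>x\<close> or its own spectral components.
  An \<open>x' \<in> D\<close> near \<open>x\<close> is used instead: \<open>e\<^sup>-\<^sup>i\<^sup>n\<^sup>z \<psi>(y \<sigma>\<^sub>z(x'))\<close> is entire with period \<open>2\<pi>\<close>, is close to
  \<open>\<psi>(y x)\<close> on the real line and close to \<open>e\<^sup>n\<^sup>\<beta> \<psi>(x y)\<close> on the line of height \<open>\<beta>\<close>.
\<close>

theorem kms_homogeneous: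
  assumes kms: "kms_state \<sigma> \<beta> \<psi>" and x: "\<And>t. \<sigma> t x = cis (n * t) *\<^sub>C x" and n: "n \<in> \<int>"
  shows "\<psi> (x * y) = of_real (exp (- n * \<beta>)) * \<psi> (y * x)"
proof -
  from kms have \<psi>: "state \<psi>" by (simp add: kms_state_def)
  from kms obtain D where D0: "closure D = UNIV" "D \<subseteq> analytic_elements \<sigma>" "\<forall>t. \<sigma> t ` D \<subseteq> D"
    and KMS0: "\<forall>x\<in>D. \<forall>y\<in>D. \<forall>f. entire_extension \<sigma> x f \<longrightarrow> \<psi> (x * y) = \<psi> (y * f (\<i> * complex_of_real \<beta>))"
    unfolding kms_state_def by (elim conjE exE) (rule that)
  have D: "closure D = UNIV" "\<And>t x. x \<in> D \<Longrightarrow> \<sigma> t x \<in> D" "D \<subseteq> analytic_elements \<sigma>"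
    by (rule D0, rule subsetD[OF D0(3)[rule_format] imageI], assumption, rule D0)
  have KMS: "\<psi> (x * y) = \<psi> (y * f (\<i> * complex_of_real \<beta>))"
    if "x \<in> D" "y \<in> D" "entire_extension \<sigma> x f" for x y f
    using KMS0[rule_format, OF that] .
  \<comment> \<open>Both sides are continuous in \<open>y\<close>, which is thereby freed from
    \<open>D\<close>. The value at imaginary time need not depend continuously on \<open>x\<close>,
    so \<open>x\<close> stays in \<open>D\<close>.\<close>
  have KMS': "\<psi> (x * y) = \<psi> (y * f (\<i> * complex_of_real \<beta>))"
    if "x \<in> D" "entire_extension \<sigma> x f" for x y f
  proof -
    have "closed {y. \<psi> (x * y) = \<psi> (y * f (\<i> * complex_of_real \<beta>))}"
      by (intro closed_Collect_eq continuous_on_state[OF \<psi>] continuous_on_mult continuous_on_const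
          continuous_on_id)
    moreover have "D \<subseteq> {y. \<psi> (x * y) = \<psi> (y * f (\<i> * complex_of_real \<beta>))}"
      using KMS[OF that(1) _ that(2)] by blast
    ultimately have "closure D \<subseteq> {y. \<psi> (x * y) = \<psi> (y * f (\<i> * complex_of_real \<beta>))}"
      by (rule closure_minimal[rotated])
    then show ?thesis unfolding D(1) by blast
  qed
  have approx: "cmod (of_real (exp (n * \<beta>)) * \<psi> (x * y) - \<psi> (y * x)) \<le> e" if "0 < e" for e
  proof -
    \<comment> \<open>The errors on the two lines add up to
      \<open>\<delta> * (exp (n * \<beta>) + 1) * norm y\<close>; using \<open>norm y + 1\<close>
      keeps the denominator positive for \<open>y = 0\<close>.\<close>
    define \<delta> where "\<delta> = e / ((exp (n * \<beta>) + 1) * (norm y + 1))"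
    have \<delta>: "0 < \<delta>" using that by (simp add: \<delta>_def add_pos_pos add_nonneg_pos)
    have "x \<in> closure D" by (simp add: D(1))
    then obtain x' where x': "x' \<in> D" "norm (x' - x) < \<delta>"
      using \<delta> by (auto simp: closure_approachable dist_norm)
    then obtain f where f: "entire_extension \<sigma> x' f"
      using D(3) by (auto simp: analytic_elements_def)
    \<comment> \<open>The flow is contractive, so the approximation is uniform in \<open>t\<close>,
      as the comparison along whole lines requires.\<close>
    have near: "norm (\<sigma> t x' - cis (n * t) *\<^sub>C x) \<le> \<delta>" for t
      using star_hom_contractive[OF flow(1), of t "x' - x"] x'(2)
      by (simp add: unital_star_homD[OF flow(1)] x)
    define k where "k z = exp (- (\<i> * of_real n * z)) * \<psi> (y * f z)" for z
    have exp_real: "exp (- (\<i> * of_real n * complex_of_real t)) = cis (- (n * t))" for t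
      by (simp add: cis_conv_exp mult.assoc)
    have cis_inv: "cis (- s) * (cis s * z) = z" for s z by (simp add: cis_mult flip: mult.assoc)
    have "cmod (of_real (exp (n * \<beta>)) * \<psi> (x * y) - \<psi> (y * x)) \<le>
        exp (n * \<beta>) * (\<delta> * norm y) + norm y * \<delta>"
    proof (rule periodic_entire_lines)
      show "k holomorphic_on UNIV"
        unfolding k_def using f
        by (intro holomorphic_intros holomorphic_entire_state[OF _ \<psi>]) (simp add: entire_extension_def)
      have k_real: "k (complex_of_real t) = cis (- (n * t)) * \<psi> (y * \<sigma> t x')" for t
        using f by (simp add: k_def entire_extension_def exp_real)
      have "cis (- (n * (t + 2 * pi))) = cis (- (n * t))" for t
      proof -
        have "- (n * (t + 2 * pi)) = - (n * t) + 2 * pi * (- n)" by (simp add: algebra_simps)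
        then show ?thesis
          using cis_multiple_2pi[of "- n"] n by (simp only: cis_mult[symmetric]) simp
      qed
      moreover have "\<sigma> (t + 2 * pi) = \<sigma> t" for t
        by (simp add: gauge_flow_def cis_mult[symmetric, of t])
      ultimately show "k (complex_of_real (t + 2 * pi)) = k (complex_of_real t)" for t
        by (simp only: k_real)
      show "2 * pi > 0" by simp
      fix t
      have "k (complex_of_real t) - \<psi> (y * x) = cis (- (n * t)) * \<psi> (y * (\<sigma> t x' - cis (n * t) *\<^sub>C x))"
        by (simp add: k_real right_diff_distrib mult_scaleC_right stateD[OF \<psi>]
            cis_inv)
      then have "cmod (k (complex_of_real t) - \<psi> (y * x)) \<le> norm (y * (\<sigma> t x' - cis (n * t) *\<^sub>C x))"
        using stateD(7)[OF \<psi>] by (simp add: norm_mult)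
      also have "\<dots> \<le> norm y * \<delta>"
        by (rule order_trans[OF norm_mult_ineq mult_left_mono[OF near norm_ge_zero]])
      finally show "cmod (k (complex_of_real t) - \<psi> (y * x)) \<le> norm y * \<delta>" .
      \<comment> \<open>By invariance \<open>\<sigma> t x'\<close> is again in \<open>D\<close>, and
        its extension is a translate of \<open>f\<close>. The KMS condition for it gives the values
        on the line of height \<beta>.\<close>
      have "entire_extension \<sigma> (\<sigma> t x') (\<lambda>z. f (z + of_real t))"
        unfolding entire_extension_def
      proof (intro conjI allI)
        have shift: "f (z + h + of_real t) = f (z + of_real t + h)" for z h
          by (simp add: ac_simps)
        show "entire (\<lambda>z. f (z + of_real t))"
          using f unfolding entire_extension_def entire_def shift by blast
        show "f (complex_of_real s + complex_of_real t) = \<sigma> s (\<sigma> t x')" for s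
          using f by (simp add: entire_extension_def flow_add flip: of_real_add)
      qed
      then have "\<psi> (\<sigma> t x' * y) = \<psi> (y * f (complex_of_real t + \<i> * of_real \<beta>))"
        using KMS'[OF D(2)[OF x'(1)]] by (simp add: add.commute)
      moreover have "exp (- (\<i> * of_real n * (complex_of_real t + \<i> * of_real \<beta>))) =
          of_real (exp (n * \<beta>)) * cis (- (n * t))"
      proof -
        have "- (\<i> * of_real n * (complex_of_real t + \<i> * of_real \<beta>)) =
            of_real (n * \<beta>) + - (\<i> * of_real n * complex_of_real t)"
          by (simp add: algebra_simps)
        then show ?thesis by (simp only: exp_add exp_real exp_of_real)
      qed
      ultimately have "k (complex_of_real t + \<i> * of_real \<beta>) - of_real (exp (n * \<beta>)) * \<psi> (x * y) =
          of_real (exp (n * \<beta>)) * (cis (- (n * t)) * \<psi> ((\<sigma> t x' - cis (n * t) *\<^sub>C x) * y))"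
        by (simp add: k_def left_diff_distrib right_diff_distrib mult_scaleC_left stateD[OF \<psi>]
            cis_inv)
      then have "cmod (k (complex_of_real t + \<i> * of_real \<beta>) - of_real (exp (n * \<beta>)) * \<psi> (x * y))
          \<le> exp (n * \<beta>) * norm ((\<sigma> t x' - cis (n * t) *\<^sub>C x) * y)"
        using stateD(7)[OF \<psi>] by (simp add: norm_mult)
      also have "\<dots> \<le> exp (n * \<beta>) * (\<delta> * norm y)"
        by (intro mult_left_mono order_trans[OF norm_mult_ineq mult_right_mono[OF near]]) auto
      finally show "cmod (k (complex_of_real t + \<i> * of_real \<beta>) - of_real (exp (n * \<beta>)) * \<psi> (x * y))
          \<le> exp (n * \<beta>) * (\<delta> * norm y)" .
    qed
    also have "\<dots> = \<delta> * (exp (n * \<beta>) + 1) * norm y" by (simp add: algebra_simps)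
    also have "\<dots> \<le> \<delta> * (exp (n * \<beta>) + 1) * (norm y + 1)"
      using \<delta> by (intro mult_left_mono mult_nonneg_nonneg add_nonneg_nonneg) auto
    also have "\<dots> = e"
    proof -
      have "exp (n * \<beta>) + 1 > 0" "norm y + 1 > 0" by (simp_all add: add_pos_pos add_nonneg_pos)
      then show ?thesis by (simp add: \<delta>_def)
    qed
    finally show ?thesis .
  qed
  have "of_real (exp (n * \<beta>)) * \<psi> (x * y) = \<psi> (y * x)"
  proof (rule ccontr)
    assume "\<not> ?thesis"
    then have "0 < cmod (of_real (exp (n * \<beta>)) * \<psi> (x * y) - \<psi> (y * x))" (is "0 < ?c") by simp
    with approx[of "?c / 2"] show False by simp
  qed
  then have "of_real (exp (- n * \<beta>)) * \<psi> (y * x) =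
      (of_real (exp (- n * \<beta>)) * of_real (exp (n * \<beta>))) * \<psi> (x * y)"
    by (simp only: mult.assoc)
  also have "complex_of_real (exp (- n * \<beta>)) * of_real (exp (n * \<beta>)) = of_real (exp (- n * \<beta> + n * \<beta>))"
    by (simp only: exp_add of_real_mult)
  finally show ?thesis by simp
qed

end

section \<open>The weak* topology and convex combinations of states\<close>

lemma topspace_weak_star [simp]: "topspace (weak_star S) = S"
  by (simp add: weak_star_def)

lemma continuous_map_weak_star_eval: "continuous_map (weak_star S) euclidean (\<lambda>\<phi>. \<phi> x)"
  unfolding weak_star_def
  by (intro continuous_map_from_subtopology continuous_map_product_projection) simp

lemma continuous_map_into_weak_star:
  assumes "\<And>x. continuous_map X euclidean (\<lambda>p. f p x)" "f \<in> topspace X \<rightarrow> S"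
  shows "continuous_map X (weak_star S) f"
  unfolding weak_star_def using assms
  by (intro continuous_map_into_subtopology) (simp_all add: continuous_map_componentwise_UNIV)

lemma state_convex:
  assumes \<phi>: "state \<phi>" and \<psi>: "state \<psi>" and s: "s \<in> {0..1}"
  shows "state (\<lambda>x. complex_of_real s * \<phi> x + complex_of_real (1 - s) * \<psi> x)"
proof (rule stateI)
  show "complex_of_real s * \<phi> (star x * x) + complex_of_real (1 - s) * \<psi> (star x * x) \<in> \<real>\<^sub>\<ge>\<^sub>0" for x
  proof -
    have "complex_of_real s \<in> \<real>\<^sub>\<ge>\<^sub>0" "complex_of_real (1 - s) \<in> \<real>\<^sub>\<ge>\<^sub>0"
      using s unfolding nonneg_Reals_of_real_iff by auto
    then show ?thesis
      using stateD(6)[OF \<phi>] stateD(6)[OF \<psi>] by (intro nonneg_Reals_add_I nonneg_Reals_mult_I)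
  qed
  show "cmod (complex_of_real s * \<phi> x + complex_of_real (1 - s) * \<psi> x) \<le> norm x" for x
  proof -
    have "cmod (complex_of_real s * \<phi> x + complex_of_real (1 - s) * \<psi> x) \<le>
        s * cmod (\<phi> x) + (1 - s) * cmod (\<psi> x)"
      using s norm_triangle_ineq[of "complex_of_real s * \<phi> x" "complex_of_real (1 - s) * \<psi> x"]
      by (simp add: norm_mult del: of_real_diff)
    also have "\<dots> \<le> s * norm x + (1 - s) * norm x"
      using s stateD(7)[OF \<phi>] stateD(7)[OF \<psi>] by (intro add_mono mult_left_mono) auto
    finally show ?thesis by (simp add: algebra_simps)
  qed
qed (simp_all add: stateD[OF \<phi>] stateD[OF \<psi>] state_one[OF \<phi>] state_one[OF \<psi>] algebra_simps)

lemma unital_star_hom_sum: "unital_star_hom f \<Longrightarrow> f (\<Sum>i\<in>I. g i) = (\<Sum>i\<in>I. f (g i))"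
  by (induction I rule: infinite_finite_induct) (simp_all add: unital_star_homD)

context toeplitz_system
begin

theorem gibbs_kms:
  assumes \<tau>: "\<tau> \<in> tracial_states" and \<beta>: "real CARD('d) * exp (- \<beta>) < 1"
    and \<psi>: "state \<psi>" "\<And>y. \<psi> (ev y) = gibbs \<alpha> \<tau> (exp (- \<beta>)) y"
  shows "kms_state \<sigma> \<beta> \<psi>"
proof -
  let ?v = "word_value (case_sum \<iota> V)"
  \<comment> \<open>The flow multiplies each word by a phase given by its degree, which is entire in
    the time variable. At \<open>\<i> * \<beta>\<close> it becomes the factor of
    \<open>gibbs_word\<close>; the dense subalgebra is \<open>range ev\<close>.\<close>
  define orbit where "orbit x z = (\<Sum>w\<in>Poly_Mapping.keys x. (Poly_Mapping.lookup x w *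
      exp (\<i> * complex_of_real (word_degree w) * z)) *\<^sub>C ?v w)" for x z
  have v: "?v w = ev (Poly_Mapping.single w 1)" for w by (simp add: free_eval_single)
  have orbit: "entire_extension \<sigma> (ev x) (orbit x)" for x
    unfolding entire_extension_def
  proof (intro conjI allI)
    show "entire (orbit x)"
      unfolding orbit_def by (intro entire_sum entire_scaleC holomorphic_intros)
    show "orbit x (complex_of_real t) = \<sigma> t (ev x)" for t
      by (simp add: orbit_def free_eval_def unital_star_hom_sum[OF flow(1)]
          unital_star_homD[OF flow(1)] flow_word_value scaleC_scaleC cis_conv_exp ac_simps)
  qed
  have "star_subalgebra (range ev)"
    unfolding star_subalgebra_def
    by (auto simp flip: free_eval_add free_eval_mult free_eval_scale free_eval_star)
      (metis free_eval_zero rangeI)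
  moreover have "range ev \<subseteq> analytic_elements \<sigma>"
    using orbit by (auto simp: analytic_elements_def)
  moreover have "closure (range ev) = UNIV" using universal by (simp add: universal_cstar_def)
  moreover have "\<sigma> t (ev x) \<in> range ev" for t x
  proof (induction x rule: free_induct)
    case (single w c)
    have "\<sigma> t (ev (Poly_Mapping.single w c)) = ev (Poly_Mapping.single w (c * cis (t * word_degree w)))"
      by (simp add: free_eval_single unital_star_homD[OF flow(1)] flow_word_value scaleC_scaleC)
    then show ?case by simp
  next
    case (add x y)
    then obtain x' y' where "\<sigma> t (ev x) = ev x'" "\<sigma> t (ev y) = ev y'" by blast
    then have "\<sigma> t (ev (x + y)) = ev (x' + y')"
      by (simp add: free_eval_add unital_star_homD[OF flow(1)])
    then show ?case by simp
  qed
  moreover have "\<psi> (ev x * ev y) = \<psi> (ev y * f (\<i> * complex_of_real \<beta>))"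
    if f: "entire_extension \<sigma> (ev x) f" for x y f
  proof -
    have "\<psi> (ev x * ev y) = (\<Sum>w\<in>Poly_Mapping.keys x. Poly_Mapping.lookup x w * \<psi> (?v w * ev y))"
      by (simp add: free_eval_def[of _ x] sum_distrib_right mult_scaleC_left state_sum[OF \<psi>(1)]
          stateD(5)[OF \<psi>(1)])
    also have "\<dots> = (\<Sum>w\<in>Poly_Mapping.keys x. (Poly_Mapping.lookup x w *
        exp (\<i> * complex_of_real (word_degree w) * (\<i> * complex_of_real \<beta>))) * \<psi> (ev y * ?v w))"
    proof (rule sum.cong[OF refl])
      fix w :: "('a + 'd) star_word"
      have "exp (\<i> * complex_of_real (word_degree w) * (\<i> * complex_of_real \<beta>)) =
          of_real (exp (- \<beta> * word_degree w))"
      proof -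
        have "\<i> * complex_of_real (word_degree w) * (\<i> * complex_of_real \<beta>) =
            of_real (- \<beta> * word_degree w)"
          by (simp add: algebra_simps)
        then show ?thesis by (simp only: exp_of_real)
      qed
      then show "Poly_Mapping.lookup x w * \<psi> (?v w * ev y) = (Poly_Mapping.lookup x w *
          exp (\<i> * complex_of_real (word_degree w) * (\<i> * complex_of_real \<beta>))) * \<psi> (ev y * ?v w)"
        by (simp only: v free_eval_mult[symmetric] \<psi>(2) gibbs_word[OF \<tau> \<beta>] mult.assoc)
    qed
    also have "\<dots> = \<psi> (ev y * orbit x (\<i> * complex_of_real \<beta>))"
      by (simp add: orbit_def sum_distrib_left mult_scaleC_right state_sum[OF \<psi>(1)]
          stateD(5)[OF \<psi>(1)])
    also have "\<dots> = \<psi> (ev y * f (\<i> * complex_of_real \<beta>))"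
    proof (rule entire_functions_eq_on_reals[where f = "\<lambda>z. \<psi> (ev y * orbit x z)"
          and g = "\<lambda>z. \<psi> (ev y * f z)"])
      show "(\<lambda>z. \<psi> (ev y * orbit x z)) holomorphic_on UNIV" "(\<lambda>z. \<psi> (ev y * f z)) holomorphic_on UNIV"
        using orbit[of x] f by (auto simp: entire_extension_def intro!: holomorphic_entire_state \<psi>(1))
      show "\<psi> (ev y * orbit x (complex_of_real t)) = \<psi> (ev y * f (complex_of_real t))" for t
        using orbit[of x] f by (simp add: entire_extension_def)
    qed
    finally show ?thesis .
  qed
  ultimately show ?thesis
    unfolding kms_state_def using \<psi>(1) by (intro conjI exI[of _ "range ev"]) (auto simp: image_iff)
qed

section \<open>Monomials\<close>

abbreviation monomial :: "'d list \<Rightarrow> 'a \<Rightarrow> 'd list \<Rightarrow> 't" where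
  "monomial \<mu> a \<nu> \<equiv> word_prod V \<mu> * \<iota> a * star (word_prod V \<nu>)"

lemma word_prod_simps [simp]:
  "word_prod V [] = 1" "word_prod V (i # \<mu>) = V i * word_prod V \<mu>"
  "word_prod V (\<mu> @ \<nu>) = word_prod V \<mu> * word_prod V \<nu>"
  by (simp_all add: word_prod_def)

lemmas \<iota>_hom = unital_star_homD[OF toeplitz_relations(1)[OF toeplitz]]

lemma coefficient_word_prod: "\<iota> a * word_prod V \<mu> = word_prod V \<mu> * \<iota> (fold \<alpha> \<mu> a)"
proof (induction \<mu> arbitrary: a)
  case (Cons i \<mu>)
  have "\<iota> a * word_prod V (i # \<mu>) = V i * (\<iota> (\<alpha> i a) * word_prod V \<mu>)"
    using toeplitz_relations(3)[OF toeplitz, of a i] by (simp flip: mult.assoc)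
  then show ?case by (simp add: Cons mult.assoc)
qed simp

lemma star_V_coefficient: "star (V i) * \<iota> a = \<iota> (\<alpha> i a) * star (V i)"
proof -
  have "\<alpha> i (star a) = star (\<alpha> i a)"
    using system by (simp add: cstar_system_def unital_star_homD(4))
  then have "star (\<iota> (star a) * V i) = star (V i * \<iota> (star (\<alpha> i a)))"
    using toeplitz_relations(3)[OF toeplitz, of "star a" i] by simp
  then show ?thesis by (simp add: star_mult \<iota>_hom star_star)
qed

text \<open>Monomials are stable under a letter in front: an element of A passes through
  \<open>word_prod V \<mu>\<close>, and \<open>V i\<close> lengthens \<mu>. A
  \<open>star (V i)\<close> meets the first letter of \<mu>, leaving a shorter word or zero, or, if
  \<mu> is empty, passes the coefficient and is appended to \<nu>.\<close>

lemma word_value_monomial: "\<exists>\<mu> a \<nu>. word_value (case_sum \<iota> V) w = monomial \<mu> a \<nu>"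
proof -
  let ?f = "\<lambda>(g, b). if b then star (case_sum \<iota> V g) else case_sum \<iota> V g"
  have "\<exists>\<mu> a \<nu>. prod_list (map ?f ls) = monomial \<mu> a \<nu>" for ls
  proof (induction ls)
    case Nil
    show ?case by (rule exI[of _ "[]"], rule exI[of _ 1], rule exI[of _ "[]"]) (simp add: \<iota>_hom)
  next
    case (Cons l ls)
    then obtain \<mu> a \<nu> where IH: "prod_list (map ?f ls) = monomial \<mu> a \<nu>" by blast
    obtain g b where l: "l = (g, b)" by (cases l)
    show ?case
    proof (cases g)
      case (Inl c)
      define c' where "c' = (if b then star c else c)"
      have "?f l = \<iota> c'" by (simp add: l Inl c'_def \<iota>_hom)
      then have "prod_list (map ?f (l # ls)) = \<iota> c' * word_prod V \<mu> * \<iota> a * star (word_prod V \<nu>)"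
        by (simp add: IH mult.assoc)
      also have "\<dots> = monomial \<mu> (fold \<alpha> \<mu> c' * a) \<nu>"
        by (simp add: coefficient_word_prod \<iota>_hom mult.assoc)
      finally show ?thesis by blast
    next
      case (Inr i)
      show ?thesis
      proof (cases b)
        case False
        then have "prod_list (map ?f (l # ls)) = monomial (i # \<mu>) a \<nu>"
          using IH by (simp add: l Inr mult.assoc)
        then show ?thesis by blast
      next
        case True
        then have *: "prod_list (map ?f (l # ls)) = star (V i) * monomial \<mu> a \<nu>"
          using IH by (simp add: l Inr)
        show ?thesis
        proof (cases \<mu>)
          case Nil
          then have "prod_list (map ?f (l # ls)) = star (V i) * \<iota> a * star (word_prod V \<nu>)"
            using * by (simp add: mult.assoc)
          also have "\<dots> = monomial [] (\<alpha> i a) (\<nu> @ [i])"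
            unfolding star_V_coefficient by (simp add: star_mult mult.assoc)
          finally show ?thesis by blast
        next
          case (Cons j \<mu>')
          have "prod_list (map ?f (l # ls)) = (star (V i) * V j) * monomial \<mu>' a \<nu>"
            using * by (simp add: Cons mult.assoc)
          also have "\<dots> = (if i = j then monomial \<mu>' a \<nu> else monomial [] 0 [])"
            by (simp add: toeplitz_relations(2)[OF toeplitz] \<iota>_hom)
          finally have eq: "prod_list (map ?f (l # ls)) =
              (if i = j then monomial \<mu>' a \<nu> else monomial [] 0 [])" .
          show ?thesis
          proof (cases "i = j")
            case True
            show ?thesis unfolding eq if_P[OF True] by blast
          next
            case False
            show ?thesis unfolding eq if_not_P[OF False] by blast
          qed
        qed
      qed
    qed
  qed
  then show ?thesis by (simp add: word_value_def)
qed

lemma state_eq_monomial: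
  assumes \<phi>: "state \<phi>" and \<psi>: "state \<psi>" and eq: "\<And>\<mu> a \<nu>. \<phi> (monomial \<mu> a \<nu>) = \<psi> (monomial \<mu> a \<nu>)"
  shows "\<phi> = \<psi>"
proof
  fix x
  show "\<phi> x = \<psi> x"
  proof (rule universal_cstar_ext[OF universal])
    show "\<phi> (ev y) = \<psi> (ev y)" for y
    proof (induction y rule: free_induct)
      case (single w c)
      then show ?case using word_value_monomial[of w] eq
        by (auto simp: free_eval_single stateD(5)[OF \<phi>] stateD(5)[OF \<psi>])
    qed (simp add: free_eval_add stateD(2)[OF \<phi>] stateD(2)[OF \<psi>])
  qed (use continuous_on_state[OF \<phi> continuous_on_id] continuous_on_state[OF \<psi> continuous_on_id] in auto)
qed

lemma norm_word_prod: "norm (word_prod V \<mu>) = 1"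
proof -
  have "star (word_prod V \<mu>) * word_prod V \<mu> = 1"
  proof (induction \<mu>)
    case (Cons i \<mu>)
    have "star (word_prod V (i # \<mu>)) * word_prod V (i # \<mu>) =
        star (word_prod V \<mu>) * (star (V i) * V i) * word_prod V \<mu>"
      by (simp add: star_mult mult.assoc)
    then show ?case by (simp add: toeplitz_relations(2)[OF toeplitz] Cons)
  qed simp
  then have "(norm (word_prod V \<mu>))\<^sup>2 = 1"
    using cstar_identity[of "word_prod V \<mu>"] by simp
  then show ?thesis by (simp add: power2_eq_1_iff) (smt (verit) norm_ge_zero)
qed

lemma flow_word_prod: "\<sigma> t (word_prod V \<mu>) = cis (real (length \<mu>) * t) *\<^sub>C word_prod V \<mu>"
  by (induction \<mu>)
    (simp_all add: unital_star_homD[OF flow(1)] flow mult_scaleC_left mult_scaleC_right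
      scaleC_scaleC cis_mult distrib_right add.commute)

text \<open>Elements of A have degree 0, where the factor \<open>exp (- n * \<beta>)\<close> is
  1.\<close>

lemma kms_state_trace:
  assumes "kms_state \<sigma> \<beta> \<psi>"
  shows "\<psi> (\<iota> (a * b)) = \<psi> (\<iota> (b * a))"
  using kms_homogeneous[OF assms, of "\<iota> a" 0 "\<iota> b"] by (simp add: flow \<iota>_hom)

lemma kms_state_monomial_bound:
  assumes kms: "kms_state \<sigma> \<beta> \<psi>" and \<beta>: "0 \<le> \<beta>" and ne: "\<mu> \<noteq> [] \<or> \<nu> \<noteq> []"
  shows "cmod (\<psi> (monomial \<mu> a \<nu>)) \<le> exp (- \<beta>) * norm (\<iota> a)"
proof -
  have \<psi>: "state \<psi>" using kms by (simp add: kms_state_def)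
  have bound: "cmod (of_real (exp (- real n * \<beta>)) * \<psi> z) \<le> exp (- \<beta>) * norm (\<iota> a)"
    if "n \<ge> 1" "norm z \<le> norm (\<iota> a)" for n z
  proof -
    have "1 * \<beta> \<le> real n * \<beta>" using that(1) \<beta> by (intro mult_right_mono) auto
    then have "exp (- real n * \<beta>) \<le> exp (- \<beta>)" by simp
    then show ?thesis
      using stateD(7)[OF \<psi>, of z] that(2) by (auto simp: norm_mult intro!: mult_mono)
  qed
  show ?thesis
  proof (cases "\<mu> = []")
    case False
    have "\<psi> (monomial \<mu> a \<nu>) = of_real (exp (- real (length \<mu>) * \<beta>)) *
        \<psi> (\<iota> a * star (word_prod V \<nu>) * word_prod V \<mu>)"
      using kms_homogeneous[OF kms flow_word_prod, of \<mu> "\<iota> a * star (word_prod V \<nu>)"]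
      by (simp add: mult.assoc)
    moreover have "norm (\<iota> a * star (word_prod V \<nu>) * word_prod V \<mu>) \<le> norm (\<iota> a)"
      using norm_mult_ineq[of "\<iota> a * star (word_prod V \<nu>)" "word_prod V \<mu>"]
        norm_mult_ineq[of "\<iota> a" "star (word_prod V \<nu>)"]
      by (simp add: norm_star norm_word_prod)
    ultimately show ?thesis using False bound[of "length \<mu>"] by (simp add: Suc_le_eq)
  next
    case True
    \<comment> \<open>The degree is negative, so the relation for this element carries a growing
      exponential; solving it for the monomial turns that into decay.\<close>
    have "\<sigma> t (star (word_prod V \<nu>)) = cis (- real (length \<nu>) * t) *\<^sub>C star (word_prod V \<nu>)" for t
      by (simp add: unital_star_homD[OF flow(1)] flow_word_prod star_scaleC cis_cnj)
    from kms_homogeneous[OF kms this, of "\<iota> a"]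
    have "of_real (exp (- real (length \<nu>) * \<beta>)) * \<psi> (star (word_prod V \<nu>) * \<iota> a) =
        (of_real (exp (- real (length \<nu>) * \<beta>)) * of_real (exp (real (length \<nu>) * \<beta>))) *
        \<psi> (monomial \<mu> a \<nu>)"
      by (simp add: True mult.assoc)
    also have "complex_of_real (exp (- real (length \<nu>) * \<beta>)) * of_real (exp (real (length \<nu>) * \<beta>)) = 1"
      by (simp flip: of_real_mult exp_add)
    finally have "\<psi> (monomial \<mu> a \<nu>) =
        of_real (exp (- real (length \<nu>) * \<beta>)) * \<psi> (star (word_prod V \<nu>) * \<iota> a)" by simp
    moreover have "norm (star (word_prod V \<nu>) * \<iota> a) \<le> norm (\<iota> a)"
      using norm_mult_ineq[of "star (word_prod V \<nu>)" "\<iota> a"] by (simp add: norm_star norm_word_prod)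
    ultimately show ?thesis using True ne bound[of "length \<nu>"] by (simp add: Suc_le_eq)
  qed
qed

section \<open>The ground states\<close>

text \<open>The choice is harmless when \<tau> is a state: the values on the dense set
  \<open>range ev\<close> determine a continuous functional.\<close>

definition vacuum :: "('a \<Rightarrow> complex) \<Rightarrow> 't \<Rightarrow> complex" where
  "vacuum \<tau> = (SOME \<psi>. state \<psi> \<and> (\<forall>y. \<psi> (ev y) = \<tau> (fock_diag \<alpha> [] y)))"

lemma vacuum:
  assumes \<tau>: "state \<tau>"
  shows "state (vacuum \<tau>)" "vacuum \<tau> (ev y) = \<tau> (fock_diag \<alpha> [] y)"
proof -
  have "\<exists>\<psi>. state \<psi> \<and> (\<forall>y. \<psi> (ev y) = \<tau> (fock_diag \<alpha> [] y))"
    by (rule universal_cstar_state[OF universal])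
      (simp_all add: fock_diag_simps stateD[OF \<tau>] state_one[OF \<tau>] fock_diag_state[OF \<tau>])
  from someI_ex[OF this] show "state (vacuum \<tau>)" "vacuum \<tau> (ev y) = \<tau> (fock_diag \<alpha> [] y)"
    by (simp_all add: vacuum_def)
qed

lemma ev_letter: "ev (letter (g, b)) = (if b then star (case_sum \<iota> V g) else case_sum \<iota> V g)"
  by (simp add: letter_def free_eval_single word_value_def)

lemma vacuum_monomial:
  assumes \<tau>: "state \<tau>"
  shows "vacuum \<tau> (monomial \<mu> a \<nu>) = (if \<mu> = [] \<and> \<nu> = [] then \<tau> a else 0)"
proof -
  have word: "word_prod V \<mu> \<in> range ev" for \<mu>
  proof (induction \<mu>)
    case Nil
    show ?case using free_eval_one[of "case_sum \<iota> V"] by (metis rangeI word_prod_simps(1))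
  next
    case (Cons i \<mu>)
    then obtain x where "word_prod V \<mu> = ev x" by blast
    then have "word_prod V (i # \<mu>) = ev (letter (Inr i, False) * x)"
      by (simp add: free_eval_mult ev_letter)
    then show ?case by blast
  qed
  have word_coefficient: "\<exists>x. word_prod V \<mu> * \<iota> a = ev x" for \<mu>
  proof -
    obtain x where "word_prod V \<mu> = ev x" using word by blast
    then have "word_prod V \<mu> * \<iota> a = ev (x * letter (Inl a, False))"
      by (simp add: free_eval_mult ev_letter)
    then show ?thesis ..
  qed
  then obtain x where x: "word_prod V \<mu> * \<iota> a = ev x" by blast
  \<comment> \<open>If \<nu> begins with \<open>i\<close>, the monomial ends in
    \<open>star (V i)\<close>, which kills the vacuum vector. If only \<mu> is nonempty, the
    monomial begins with a creation operator, whose range has no component at the empty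
    word.\<close>
  consider "\<nu> = []" "\<mu> = []" | i \<nu>' where "\<nu> = i # \<nu>'" | i \<mu>' where "\<nu> = []" "\<mu> = i # \<mu>'"
    by (cases \<mu>; cases \<nu>) auto
  then show ?thesis
  proof cases
    case 1
    have "vacuum \<tau> (ev (letter (Inl a, False) * 1)) = \<tau> (a * 1)"
      by (simp add: vacuum(2)[OF \<tau>] fock_diag_letter_Inl fock_diag_simps del: mult_1_right)
    then show ?thesis using 1 by (simp add: ev_letter)
  next
    case (2 i \<nu>')
    obtain z where "word_prod V \<nu>' = ev z" using word by blast
    then have "monomial \<mu> a \<nu> = ev ((x * free_star z) * letter (Inr i, True))"
      using 2 by (simp add: x star_mult free_eval_mult free_eval_star ev_letter mult.assoc)
    then show ?thesis
      using 2 by (simp only: vacuum(2)[OF \<tau>] fock_diag_letter_Inr stateD(4)[OF \<tau>]) simp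
  next
    case (3 i \<mu>')
    obtain z where "word_prod V \<mu>' * \<iota> a = ev z" using word_coefficient by blast
    then have "monomial \<mu> a \<nu> = ev (letter (Inr i, False) * z)"
      using 3 by (simp add: free_eval_mult ev_letter mult.assoc)
    then show ?thesis
      using 3 by (simp only: vacuum(2)[OF \<tau>] fock_diag_letter_Inr stateD(4)[OF \<tau>]) simp
  qed
qed

lemma vacuum_kms_infinity:
  assumes \<tau>: "\<tau> \<in> tracial_states"
  shows "vacuum \<tau> \<in> kms_infinity_states \<sigma>"
proof -
  have st: "state \<tau>" using \<tau> by (simp add: tracial_states_def)
  define q where "q \<beta> = real CARD('d) * exp (- \<beta>)" for \<beta>
  have q0: "(q \<longlongrightarrow> 0) at_top"
    unfolding q_def
    by (rule tendsto_mult_right_zero, rule filterlim_compose[OF exp_at_bot filterlim_uminus_at_bot_at_top])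
  \<comment> \<open>Meaningful only when \<open>q \<beta> < 1\<close>, that is for all large
    \<beta>. The filter required by \<open>kms_infinity_states\<close> is the image of
    \<open>at_top\<close> under the graph of \<Phi>.\<close>
  define \<Phi> where "\<Phi> \<beta> = (SOME \<psi>. state \<psi> \<and> (\<forall>y. \<psi> (ev y) = gibbs \<alpha> \<tau> (exp (- \<beta>)) y))" for \<beta>
  have \<Phi>: "state (\<Phi> \<beta>)" "\<Phi> \<beta> (ev y) = gibbs \<alpha> \<tau> (exp (- \<beta>)) y" if "q \<beta> < 1" for \<beta> y
    using someI_ex[OF gibbs_state[OF st, of "exp (- \<beta>)"]] that by (simp_all add: \<Phi>_def q_def)
  have small: "\<forall>\<^sub>F \<beta> in at_top. q \<beta> < 1"
    using order_tendstoD(2)[OF q0, of 1] by simp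
  have near: "cmod (\<Phi> \<beta> x - vacuum \<tau> x) \<le> 2 * q \<beta> * norm x" if "q \<beta> < 1" for \<beta> x
  proof (rule universal_cstar_dense[OF universal])
    show "closed {x. cmod (\<Phi> \<beta> x - vacuum \<tau> x) \<le> 2 * q \<beta> * norm x}"
      by (intro closed_Collect_le continuous_on_norm continuous_on_diff continuous_on_mult
          continuous_on_const continuous_on_id continuous_on_state[OF \<Phi>(1)[OF that]]
          continuous_on_state[OF vacuum(1)[OF st]])
    show "cmod (\<Phi> \<beta> (ev y) - vacuum \<tau> (ev y)) \<le> 2 * q \<beta> * norm (ev y)" for y
      using gibbs_vacuum[OF st, of "exp (- \<beta>)" y] that
      by (simp add: \<Phi>(2)[OF that] vacuum(2)[OF st] q_def)
  qed
  have "((\<lambda>\<beta>. \<Phi> \<beta> x) \<longlongrightarrow> vacuum \<tau> x) at_top" for x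
  proof (rule LIM_zero_cancel, rule Lim_null_comparison)
    show "\<forall>\<^sub>F \<beta> in at_top. cmod (\<Phi> \<beta> x - vacuum \<tau> x) \<le> 2 * q \<beta> * norm x"
      using small by eventually_elim (rule near)
    show "((\<lambda>\<beta>. 2 * q \<beta> * norm x) \<longlongrightarrow> 0) at_top"
      by (intro tendsto_mult_left_zero tendsto_mult_right_zero q0)
  qed
  moreover have "\<forall>\<^sub>F \<beta> in at_top. kms_state \<sigma> \<beta> (\<Phi> \<beta>)"
    using small by eventually_elim (rule gibbs_kms[OF \<tau>]; simp add: \<Phi> q_def[symmetric])
  moreover have "filtermap (\<lambda>\<beta>. (\<beta>, \<Phi> \<beta>)) at_top \<noteq> bot"
    by (simp add: filtermap_bot_iff)
  ultimately show ?thesis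
    unfolding kms_infinity_states_def using vacuum(1)[OF st]
    by (intro CollectI conjI exI[of _ "filtermap (\<lambda>\<beta>. (\<beta>, \<Phi> \<beta>)) at_top"])
      (simp_all add: eventually_filtermap filterlim_filtermap filterlim_ident)
qed

lemma kms_infinity_statesD:
  assumes "\<psi> \<in> kms_infinity_states \<sigma>"
  shows "state \<psi>" "\<psi> \<circ> \<iota> \<in> tracial_states"
    "\<mu> \<noteq> [] \<or> \<nu> \<noteq> [] \<Longrightarrow> \<psi> (monomial \<mu> a \<nu>) = 0"
proof -
  from assms obtain F :: "(real \<times> ('t \<Rightarrow> complex)) filter" where
    st: "state \<psi>" and F: "F \<noteq> bot" "\<forall>\<^sub>F p in F. kms_state \<sigma> (fst p) (snd p)" "filterlim fst at_top F"
    and lim: "\<And>x. ((\<lambda>p. snd p x) \<longlongrightarrow> \<psi> x) F"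
    unfolding kms_infinity_states_def by (auto simp: case_prod_unfold)
  show "state \<psi>" by fact
  have "state (\<psi> \<circ> \<iota>)"
  proof (rule stateI)
    show "cmod ((\<psi> \<circ> \<iota>) a) \<le> norm a" for a
      using order_trans[OF stateD(7)[OF st] star_hom_contractive[OF toeplitz_relations(1)[OF toeplitz]]]
      by simp
  qed (simp_all add: \<iota>_hom stateD[OF st] state_one[OF st])
  moreover have "(\<psi> \<circ> \<iota>) (a * b) = (\<psi> \<circ> \<iota>) (b * a)" for a b
  proof -
    have "\<forall>\<^sub>F p in F. snd p (\<iota> (a * b)) = snd p (\<iota> (b * a))"
      using F(2) by eventually_elim (rule kms_state_trace)
    then have "((\<lambda>p. snd p (\<iota> (b * a))) \<longlongrightarrow> \<psi> (\<iota> (a * b))) F"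
      using lim by (rule Lim_transform_eventually[rotated])
    with lim show ?thesis using tendsto_unique[OF F(1)] by auto
  qed
  ultimately show "\<psi> \<circ> \<iota> \<in> tracial_states" by (simp add: tracial_states_def)
  assume ne: "\<mu> \<noteq> [] \<or> \<nu> \<noteq> []"
  have "((\<lambda>p. snd p (monomial \<mu> a \<nu>)) \<longlongrightarrow> 0) F"
  proof (rule Lim_null_comparison)
    \<comment> \<open>Replacing \<open>exp (- n * \<beta>)\<close> by \<open>exp (- \<beta>)\<close>
      in the monomial bound takes a nonnegative \<beta>.\<close>
    have "\<forall>\<^sub>F p in F. 0 \<le> fst p" using F(3) by (simp add: filterlim_at_top)
    with F(2) show "\<forall>\<^sub>F p in F. cmod (snd p (monomial \<mu> a \<nu>)) \<le> exp (- fst p) * norm (\<iota> a)"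
      by eventually_elim (rule kms_state_monomial_bound[OF _ _ ne])
    have "((\<lambda>p. exp (- fst p)) \<longlongrightarrow> 0) F"
      by (rule filterlim_compose[OF exp_at_bot filterlim_compose[OF filterlim_uminus_at_bot_at_top F(3)]])
    then show "((\<lambda>p. exp (- fst p) * norm (\<iota> a)) \<longlongrightarrow> 0) F" by (rule tendsto_mult_left_zero)
  qed
  then show "\<psi> (monomial \<mu> a \<nu>) = 0" using tendsto_unique[OF F(1) lim] by blast
qed

lemma vacuum_\<iota>: "state \<tau> \<Longrightarrow> vacuum \<tau> \<circ> \<iota> = \<tau>"
  using vacuum_monomial[of \<tau> "[]" _ "[]"] by (simp add: fun_eq_iff)

lemma vacuum_restrict:
  assumes "\<psi> \<in> kms_infinity_states \<sigma>"
  shows "vacuum (\<psi> \<circ> \<iota>) = \<psi>"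
proof (rule state_eq_monomial)
  note \<psi> = kms_infinity_statesD[OF assms]
  have st: "state (\<psi> \<circ> \<iota>)" using \<psi>(2) by (simp add: tracial_states_def)
  show "state (vacuum (\<psi> \<circ> \<iota>))" by (rule vacuum(1)[OF st])
  show "state \<psi>" by (rule \<psi>(1))
  show "vacuum (\<psi> \<circ> \<iota>) (monomial \<mu> a \<nu>) = \<psi> (monomial \<mu> a \<nu>)" for \<mu> a \<nu>
    using \<psi>(3) fun_cong[OF vacuum_\<iota>[OF st], of a]
    by (cases "\<mu> = [] \<and> \<nu> = []") (auto simp: vacuum_monomial[OF st])
qed

lemma vacuum_affine:
  assumes \<tau>1: "state \<tau>\<^sub>1" and \<tau>2: "state \<tau>\<^sub>2" and s: "s \<in> {0..1}"
  shows "vacuum (\<lambda>a. complex_of_real s * \<tau>\<^sub>1 a + complex_of_real (1 - s) * \<tau>\<^sub>2 a) =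
    (\<lambda>x. complex_of_real s * vacuum \<tau>\<^sub>1 x + complex_of_real (1 - s) * vacuum \<tau>\<^sub>2 x)"
  by (rule state_eq_monomial)
    (simp_all only: vacuum vacuum_monomial state_convex[OF _ _ s] \<tau>1 \<tau>2, simp)

text \<open>At \<open>ev y\<close> the value is \<tau> evaluated at the fixed element
  \<open>fock_diag \<alpha> [] y\<close> of A, hence weak* continuous. A general \<open>x\<close> is
  a limit of such elements, and the convergence is uniform in \<tau> since states are
  contractive.\<close>

lemma continuous_map_vacuum_eval:
  "continuous_map (weak_star tracial_states) euclidean (\<lambda>\<tau>. vacuum \<tau> x)"
proof -
  have st: "state \<tau>" if "\<tau> \<in> tracial_states" for \<tau> :: "'a \<Rightarrow> complex"
    using that by (simp add: tracial_states_def)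
  have "x \<in> closure (range ev)" using universal by (simp add: universal_cstar_def)
  then obtain X where X_ev: "\<forall>n. X n \<in> range ev" and X: "X \<longlonglongrightarrow> x"
    by (auto simp: closure_sequential)
  from X_ev have "\<forall>n. \<exists>y. X n = ev y" by (simp add: image_iff)
  then obtain y where y: "\<forall>n. X n = ev (y n)" by (rule choice[THEN exE])
  have "continuous_map (weak_star tracial_states) Met_TC.mtopology (\<lambda>\<tau>. vacuum \<tau> x)"
  proof (rule Met_TC.continuous_map_uniform_limit)
    have "continuous_map (weak_star tracial_states) euclidean (\<lambda>\<tau>. vacuum \<tau> (X n))" for n
      by (rule continuous_map_eq[OF continuous_map_weak_star_eval[of _ "fock_diag \<alpha> [] (y n)"]])
        (simp add: y vacuum(2)[OF st])
    then show "\<forall>\<^sub>F n in sequentially.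
        continuous_map (weak_star tracial_states) Met_TC.mtopology (\<lambda>\<tau>. vacuum \<tau> (X n))"
      by simp
    fix e :: real assume "0 < e"
    then have "\<forall>\<^sub>F n in sequentially. norm (X n - x) < e"
      using tendstoD[OF X] by (simp add: dist_norm)
    then show "\<forall>\<^sub>F n in sequentially. \<forall>\<tau>\<in>topspace (weak_star tracial_states).
        vacuum \<tau> x \<in> UNIV \<and> dist (vacuum \<tau> (X n)) (vacuum \<tau> x) < e"
    proof eventually_elim
      case (elim n)
      have "dist (vacuum \<tau> (X n)) (vacuum \<tau> x) < e" if "\<tau> \<in> tracial_states" for \<tau>
        using stateD(7)[OF vacuum(1)[OF st[OF that]], of "X n - x"] elim
        by (simp add: dist_norm stateD(3)[OF vacuum(1)[OF st[OF that]]])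
      then show ?case by simp
    qed
  qed simp
  then show ?thesis by simp
qed

text \<open>With the inverse \<open>\<lambda>\<psi>. \<psi> \<circ> \<iota>\<close> at hand,
  continuity in each direction is a statement about evaluations at single points; no compactness
  argument is involved.\<close>

theorem homeomorphic_map_vacuum:
  "homeomorphic_map (weak_star tracial_states) (weak_star (kms_infinity_states \<sigma>)) vacuum"
  unfolding homeomorphic_map_maps homeomorphic_maps_def
proof (intro exI[of _ "\<lambda>\<psi>. \<psi> \<circ> \<iota>"] conjI)
  show "continuous_map (weak_star tracial_states) (weak_star (kms_infinity_states \<sigma>)) vacuum"
    using vacuum_kms_infinity
    by (intro continuous_map_into_weak_star continuous_map_vacuum_eval) auto
  show "continuous_map (weak_star (kms_infinity_states \<sigma>)) (weak_star tracial_states) (\<lambda>\<psi>. \<psi> \<circ> \<iota>)"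
    using kms_infinity_statesD(2)
    by (intro continuous_map_into_weak_star) (auto intro: continuous_map_weak_star_eval)
  show "\<forall>\<tau>\<in>topspace (weak_star tracial_states). vacuum \<tau> \<circ> \<iota> = \<tau>"
    using vacuum_\<iota> by (simp add: tracial_states_def)
  show "\<forall>\<psi>\<in>topspace (weak_star (kms_infinity_states \<sigma>)). vacuum (\<psi> \<circ> \<iota>) = \<psi>"
    using vacuum_restrict by simp
qed

end

theorem proposition3p5:
  fixes \<alpha> :: "'d::finite \<Rightarrow> 'a::unital_cstar_algebra \<Rightarrow> 'a"
    and \<iota> :: "'a \<Rightarrow> 't::unital_cstar_algebra"
    and V :: "'d \<Rightarrow> 't"
  assumes "cstar_system \<alpha>"
    and "toeplitz_algebra \<alpha> \<iota> V"
  shows "\<exists>\<Psi> :: ('a \<Rightarrow> complex) \<Rightarrow> ('t \<Rightarrow> complex).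
    (\<forall>\<tau>\<in>tracial_states. \<forall>\<mu> \<nu> a.
       \<Psi> \<tau> (word_prod V \<mu> * \<iota> a * star (word_prod V \<nu>)) =
         (if \<mu> = [] \<and> \<nu> = [] then \<tau> a else 0)) \<and>
    (\<forall>\<tau>\<^sub>1\<in>tracial_states. \<forall>\<tau>\<^sub>2\<in>tracial_states. \<forall>s\<in>{0..1}.
       \<Psi> (\<lambda>a. complex_of_real s * \<tau>\<^sub>1 a + complex_of_real (1 - s) * \<tau>\<^sub>2 a) =
         (\<lambda>x. complex_of_real s * \<Psi> \<tau>\<^sub>1 x + complex_of_real (1 - s) * \<Psi> \<tau>\<^sub>2 x)) \<and>
    homeomorphic_map (weak_star tracial_states)
      (weak_star (kms_infinity_states (gauge_flow \<iota> V))) \<Psi>"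
proof -
  interpret toeplitz_system \<alpha> \<iota> V using assms by unfold_locales
  have st: "state \<tau>" if "\<tau> \<in> tracial_states" for \<tau> :: "'a \<Rightarrow> complex"
    using that by (simp add: tracial_states_def)
  show ?thesis
    by (intro exI[of _ vacuum] conjI ballI allI vacuum_monomial vacuum_affine
        homeomorphic_map_vacuum st)
qed

end
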